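(* Let $d\ge 2$ and let $\phi:\mathbb{R}^d\times\mathbb{R}^d\to\mathbb{R}$ be homogeneous of degree one, i.e. $\phi(\lambda x,\lambda y)=\lambda\phi(x,y)$ for all $\lambda>0$, and of class $C^{\lfloor d/2\rfloor+1}$ away from the origin. Let $B\subset\mathbb{R}^d$ be the unit ball. Suppose that for every $t>0$ one has $$\nabla_x\phi(x,y)\neq \vec 0\quad\text{and}\quad \nabla_y\phi(x,y)\neq\vec 0$$ for $(x,y)$ in a neighborhood of $\{(x,y)\in B\times B:\phi(x,y)=t\}$, and that for every $t>0$ the Monge-Ampere determinant $$\det\begin{pmatrix}0&\nabla_x\phi\\ -(\nabla_y\phi)^T&\dfrac{\partial^2\phi}{\partial x_i\partial y_j}\end{pmatrix}$$ does not vanish at any point of $\{(x,y)\in B\times B:\phi(x,y)=t\}$. Let $C>0$ be a constant (allowed to depend on $\phi$). Then there is a constant $K$, depending only on $d,\phi,C$, such that for all $q\ge1$ and all $\delta>0$, $$q^{-d}\,\#\{(n,m)\in\mathbb{Z}^d\times\mathbb{Z}^d:\ |n|,|m|\le Cq,\ q\le\phi(n,m)\le q+\delta\}\le K\max\{q^{d-2+\frac{2}{d+1}},\,q^{d-1}\delta\}.$$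
   Context: In the Monge-Ampere matrix, which is $(d+1)\times(d+1)$, the top row is $(0,\partial\phi/\partial x_1,\dots,\partial\phi/\partial x_d)$, the first column is $(0,-\partial\phi/\partial y_1,\dots,-\partial\phi/\partial y_d)^T$, and the remaining $d\times d$ block has entry $\partial^2\phi/\partial x_i\partial y_j$ in the column corresponding to $x_i$ and the row corresponding to $y_j$. *)

theory Defs
  imports "HOL-Analysis.Analysis"
begin

text \<open>
  Class \<open>C\<^sup>k\<close> on an open set of a Euclidean space: all iterated partial derivatives (along
  the standard basis) of order at most \<open>k\<close> exist and are continuous. At each order below \<open>k\<close> total
  differentiability is demanded, as it holds automatically for \<open>C\<^sup>1\<close> functions.
\<close>

primrec C_class_on :: "nat \<Rightarrow> ('a::euclidean_space \<Rightarrow> real) \<Rightarrow> 'a set \<Rightarrow> bool" where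
  "C_class_on 0 f S \<longleftrightarrow> continuous_on S f"
| "C_class_on (Suc k) f S \<longleftrightarrow>
     (\<forall>p\<in>S. f differentiable (at p)) \<and>
     (\<forall>b\<in>Basis. C_class_on k (\<lambda>p. frechet_derivative f (at p) b) S)"

definition dx :: "'n \<Rightarrow> ((real^'n) \<times> (real^'n) \<Rightarrow> real) \<Rightarrow> (real^'n) \<times> (real^'n) \<Rightarrow> real" where
  "dx i f p = frechet_derivative f (at p) (axis i 1, 0)"

definition dy :: "'n \<Rightarrow> ((real^'n) \<times> (real^'n) \<Rightarrow> real) \<Rightarrow> (real^'n) \<times> (real^'n) \<Rightarrow> real" where
  "dy j f p = frechet_derivative f (at p) (0, axis j 1)"

definition grad_x :: "((real^'n) \<times> (real^'n) \<Rightarrow> real) \<Rightarrow> (real^'n) \<times> (real^'n) \<Rightarrow> real^'n" where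
  "grad_x f p = (\<chi> i. dx i f p)"

definition grad_y :: "((real^'n) \<times> (real^'n) \<Rightarrow> real) \<Rightarrow> (real^'n) \<times> (real^'n) \<Rightarrow> real^'n" where
  "grad_y f p = (\<chi> j. dy j f p)"

text \<open>
  The \<open>(d+1) \<times> (d+1)\<close> Monge-Ampere matrix, with rows and columns indexed by \<open>'n option\<close>: the
  index \<open>None\<close> is the extra (first) one. The first argument of the case distinction is the row.
\<close>

definition monge_ampere_matrix ::
    "((real^'n) \<times> (real^'n) \<Rightarrow> real) \<Rightarrow> (real^'n) \<times> (real^'n) \<Rightarrow> real^('n option)^('n option)" where
  "monge_ampere_matrix f p = (\<chi> r c. case (r, c) of
       (None, None) \<Rightarrow> 0
     | (None, Some i) \<Rightarrow> grad_x f p $ i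
     | (Some j, None) \<Rightarrow> - grad_y f p $ j
     | (Some j, Some i) \<Rightarrow> dx i (dy j f) p)"

definition int_points :: "(real^'n) set" where
  "int_points = {v. \<forall>i. v $ i \<in> \<int>}"

end

theory Submission
  imports Defs
begin

text \<open>
  Put \<open>r = q^(1/(d+1))\<close> and \<open>\<delta> = r^(1-d)\<close>. Confine \<open>m\<close> to a cube of side \<open>r\<close> around some \<open>m\<^sub>0\<close>. For fixed
  \<open>n\<close>, Taylor expansion shows that the difference \<open>h\<close> of two admissible \<open>m\<close> satisfies
  \<open>\<bar>h \<bullet> \<nabla>\<^sub>y \<phi>(n, m\<^sub>0)\<bar> \<le> O(\<delta>)\<close>. So the number of admissible pairs is at most the number of pairs \<open>(n, h)\<close>
  with this property, \<open>\<bar>h\<bar> \<le> O(r)\<close> and \<open>\<phi>(n, m\<^sub>0) = t + O(r)\<close>. For fixed \<open>h \<noteq> 0\<close> these are two conditions on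
  \<open>n\<close>, transversal by the Monge-Ampere condition, confining \<open>n\<close> to widths \<open>r\<close> and \<open>q \<delta> / \<bar>h\<bar>\<close>. Both widths are
  bounded below, hence there are \<open>O(q^(d-1) r \<delta> / \<bar>h\<bar>)\<close> such \<open>n\<close>; summing over \<open>h\<close> costs \<open>r^(d-1) = 1/\<delta>\<close>, so
  that each of the \<open>(q/r)^d\<close> cubes contributes \<open>O(q^(d-1) r)\<close>. Longer intervals are cut into pieces of
  length \<open>\<delta>\<close>.
\<close>

section \<open>Derivatives and integer points\<close>

lemma has_derivative_grad:
  fixes f :: "(real^'n) \<times> (real^'n) \<Rightarrow> real"
  assumes "f differentiable (at p)"
  shows "(f has_derivative (\<lambda>h. grad_x f p \<bullet> fst h + grad_y f p \<bullet> snd h)) (at p)"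
proof -
  let ?D = "frechet_derivative f (at p)"
  have D: "(f has_derivative ?D) (at p)"
    using assms by (simp add: frechet_derivative_works)
  then have lin: "linear ?D"
    by (rule has_derivative_linear)
  have "?D h = grad_x f p \<bullet> fst h + grad_y f p \<bullet> snd h" for h
  proof -
    have "h = (\<Sum>i\<in>UNIV. (fst h $ i) *\<^sub>R (axis i 1, 0)) + (\<Sum>i\<in>UNIV. (snd h $ i) *\<^sub>R (0, axis i 1))"
      using basis_expansion[of "fst h"] basis_expansion[of "snd h"]
      by (simp add: prod_eq_iff fst_sum snd_sum scalar_mult_eq_scaleR)
    then have "?D h = ?D ((\<Sum>i\<in>UNIV. (fst h $ i) *\<^sub>R (axis i 1, 0)) + (\<Sum>i\<in>UNIV. (snd h $ i) *\<^sub>R (0, axis i 1)))"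
      by simp
    also have "\<dots> = (\<Sum>i\<in>UNIV. (fst h $ i) * dx i f p) + (\<Sum>i\<in>UNIV. (snd h $ i) * dy i f p)"
      by (simp only: linear_add[OF lin] linear_sum[OF lin] linear_cmul[OF lin] dx_def dy_def real_scaleR_def)
    finally show ?thesis
      by (simp add: inner_vec_def grad_x_def grad_y_def mult.commute)
  qed
  then have "?D = (\<lambda>h. grad_x f p \<bullet> fst h + grad_y f p \<bullet> snd h)"
    by (rule ext)
  with D show ?thesis
    by simp
qed

lemma mvt_closed_segment:
  fixes f :: "'a::real_normed_vector \<Rightarrow> real"
  assumes "\<And>x. x \<in> closed_segment a b \<Longrightarrow> (f has_derivative f' x) (at x)"
  obtains x where "x \<in> closed_segment a b" "f b - f a = f' x (b - a)"
proof -
  let ?g = "\<lambda>t::real. a + t *\<^sub>R (b - a)"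
  have seg: "?g t \<in> closed_segment a b" if "0 \<le> t" "t \<le> 1" for t
    using that unfolding closed_segment_def by (auto simp: algebra_simps intro!: exI[of _ t])
  have "((\<lambda>t. f (?g t)) has_derivative (\<lambda>s. f' (?g t) (s *\<^sub>R (b - a)))) (at t within {0..1})"
    if "0 \<le> t" "t \<le> 1" for t
    by (rule has_derivative_compose[where f = "?g", OF _ assms[OF seg[OF that]]])
      (auto intro!: derivative_eq_intros)
  from mvt_very_simple[of 0 1 "\<lambda>t. f (?g t)", OF _ this]
  obtain t where "t \<in> {0..1}" "f (?g 1) - f (?g 0) = f' (?g t) ((1 - 0) *\<^sub>R (b - a))"
    by auto
  then show thesis
    using that[OF seg[of t]] by auto
qed

lemma C_class_on_continuous: "C_class_on k f S \<Longrightarrow> open S \<Longrightarrow> continuous_on S f"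
  by (cases k) (auto intro!: continuous_at_imp_continuous_on differentiable_imp_continuous_within)

lemma C_class_on_dx: "C_class_on (Suc k) f S \<Longrightarrow> C_class_on k (dx i f) S"
  using axis_in_Basis_iff[of i "1::real"] by (simp add: dx_def[abs_def] Basis_prod_def)

lemma C_class_on_dy: "C_class_on (Suc k) f S \<Longrightarrow> C_class_on k (dy i f) S"
  using axis_in_Basis_iff[of i "1::real"] by (simp add: dy_def[abs_def] Basis_prod_def)

section \<open>Counting integer points in boxes\<close>

lemma card_integer_interval_le:
  fixes R :: real
  assumes "R \<ge> 0"
  shows "real (card {- \<lfloor>R\<rfloor>..\<lfloor>R\<rfloor>}) \<le> 2 * R + 1"
  using assms of_int_floor_le[of R] by (simp add: of_nat_nat)

lemma int_points_coord_eq_floor: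
  "m \<in> int_points \<Longrightarrow> m $ i = of_int \<lfloor>m $ i\<rfloor>"
  by (auto simp: int_points_def elim: Ints_cases)

lemma floor_in_integer_interval:
  fixes x R :: real
  assumes "\<bar>x\<bar> \<le> R" "x \<in> \<int>"
  shows "\<lfloor>x\<rfloor> \<in> {- \<lfloor>R\<rfloor>..\<lfloor>R\<rfloor>}"
proof -
  obtain k where k: "x = of_int k" using assms(2) by (auto elim: Ints_cases)
  have "k \<le> \<lfloor>R\<rfloor>" "- k \<le> \<lfloor>R\<rfloor>"
    using assms(1) k by (auto simp: le_floor_iff)
  then show ?thesis using k by auto
qed

text \<open>Coding an integer vector by the function of its integer coordinates lets boxes be
  counted as \<open>PiE\<close> products, whose cardinality is a plain power.\<close>

lemma inj_on_floor_int_points: "inj_on (\<lambda>(m::real^'n) k. \<lfloor>m $ k\<rfloor>) int_points"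
proof (rule inj_onI)
  fix m m' :: "real^'n"
  assume *: "m \<in> int_points" "m' \<in> int_points" "(\<lambda>k. \<lfloor>m $ k\<rfloor>) = (\<lambda>k. \<lfloor>m' $ k\<rfloor>)"
  then show "m = m'"
    using int_points_coord_eq_floor[of m] int_points_coord_eq_floor[of m']
    by (metis (mono_tags, lifting) vec_eq_iff)
qed

lemma floor_image_int_points_cube:
  fixes R :: real and A :: "(real^'n) set"
  assumes "A \<subseteq> int_points" "\<And>m k. m \<in> A \<Longrightarrow> \<bar>m $ k\<bar> \<le> R"
  shows "(\<lambda>m k. \<lfloor>m $ k\<rfloor>) ` A \<subseteq> PiE UNIV (\<lambda>_. {- \<lfloor>R\<rfloor>..\<lfloor>R\<rfloor>})"
  using assms by (auto simp: int_points_def simp del: atLeastAtMost_iff intro!: floor_in_integer_interval)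

lemma finite_int_points_cube:
  fixes R :: real and A :: "(real^'n) set"
  assumes "A \<subseteq> int_points" "\<And>m k. m \<in> A \<Longrightarrow> \<bar>m $ k\<bar> \<le> R"
  shows "finite A"
proof (rule finite_imageD)
  show "finite ((\<lambda>m k. \<lfloor>m $ k\<rfloor>) ` A)"
    by (rule finite_subset[OF floor_image_int_points_cube[OF assms]]) (auto intro: finite_PiE)
  show "inj_on (\<lambda>m k. \<lfloor>m $ k\<rfloor>) A"
    by (rule inj_on_subset[OF inj_on_floor_int_points assms(1)])
qed

lemma card_int_points_cube_le:
  fixes R :: real and A :: "(real^'n) set"
  assumes R: "R \<ge> 0" and A: "A \<subseteq> int_points" "\<And>m k. m \<in> A \<Longrightarrow> \<bar>m $ k\<bar> \<le> R"
  shows "real (card A) \<le> (2 * R + 1) ^ CARD('n)"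
proof -
  let ?P = "PiE (UNIV::'n set) (\<lambda>_. {- \<lfloor>R\<rfloor>..\<lfloor>R\<rfloor>})"
  have "card A \<le> card ?P"
    by (rule card_inj_on_le[OF inj_on_subset[OF inj_on_floor_int_points A(1)] floor_image_int_points_cube[OF A]])
      (auto intro: finite_PiE)
  then have "real (card A) \<le> real (card {- \<lfloor>R\<rfloor>..\<lfloor>R\<rfloor>}) ^ CARD('n)"
    by (simp only: card_PiE finite prod_constant of_nat_power[symmetric] of_nat_le_iff)
  also have "\<dots> \<le> (2 * R + 1) ^ CARD('n)"
    by (intro power_mono card_integer_interval_le R) simp
  finally show ?thesis .
qed

text \<open>
  With \<open>i = j\<close> and \<open>G\<close> constant this is the corresponding bound for a single function \<open>F\<close>.
\<close>

lemma card_int_points_separated_le: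
  fixes A :: "(real^'n) set" and F G :: "real^'n \<Rightarrow> real" and R :: real
  assumes A: "A \<subseteq> int_points" "\<And>m k. m \<in> A \<Longrightarrow> \<bar>m $ k\<bar> \<le> R"
    and R: "R \<ge> 0" and \<kappa>: "\<kappa> > 0"
    and F: "\<And>m. m \<in> A \<Longrightarrow> s \<le> F m \<and> F m \<le> s + a" "a \<ge> 0"
    and G: "\<And>m. m \<in> A \<Longrightarrow> t \<le> G m \<and> G m \<le> t + b" "b \<ge> 0"
    and sep: "\<And>m m'. \<lbrakk>m \<in> A; m' \<in> A; \<And>k. k \<notin> {i, j} \<Longrightarrow> m $ k = m' $ k;
        \<bar>F m - F m'\<bar> < \<kappa>; \<bar>G m - G m'\<bar> < \<kappa>\<rbrakk> \<Longrightarrow> m = m'"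
  shows "real (card A) \<le> (2 * R + 1) ^ (CARD('n) - card {i, j}) * (a / \<kappa> + 1) * (b / \<kappa> + 1)"
proof -
  let ?P = "PiE (- {i, j}) (\<lambda>_. {- \<lfloor>R\<rfloor>..\<lfloor>R\<rfloor>})"
  \<comment> \<open>The code keeps the coordinates outside \<open>{i, j}\<close> exactly and records
    \<open>F\<close> and \<open>G\<close> only by a cell of length \<open>\<kappa>\<close>. Equal
    codes make both values agree up to less than \<open>\<kappa>\<close>, so \<open>sep\<close>
    gives injectivity and it remains to count codes.\<close>
  let ?g = "\<lambda>m. (restrict (\<lambda>k. \<lfloor>m $ k\<rfloor>) (- {i, j}), \<lfloor>(F m - s) / \<kappa>\<rfloor>, \<lfloor>(G m - t) / \<kappa>\<rfloor>)"
  have near: "\<bar>x - y\<bar> < \<kappa>" if "\<lfloor>(x - s) / \<kappa>\<rfloor> = \<lfloor>(y - s) / \<kappa>\<rfloor>" for x y s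
  proof -
    have "\<bar>(x - s) / \<kappa> - (y - s) / \<kappa>\<bar> < 1"
      using that by linarith
    then have "\<bar>(x - y) / \<kappa>\<bar> < 1"
      by (simp add: diff_divide_distrib)
    then show ?thesis
      using \<kappa> by (simp add: divide_simps)
  qed
  have "inj_on ?g A"
  proof (rule inj_onI)
    fix m m' assume *: "m \<in> A" "m' \<in> A" "?g m = ?g m'"
    have "m $ k = m' $ k" if "k \<notin> {i, j}" for k
    proof -
      have "\<lfloor>m $ k\<rfloor> = \<lfloor>m' $ k\<rfloor>"
        using *(3) that by (auto dest!: fun_cong[of _ _ k])
      then show ?thesis
        using * A int_points_coord_eq_floor[of m] int_points_coord_eq_floor[of m']
        by (metis subsetD)
    qed
    then show "m = m'"
      using sep[OF *(1,2)] near *(3) by auto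
  qed
  moreover have "?g ` A \<subseteq> ?P \<times> {0..\<lfloor>a / \<kappa>\<rfloor>} \<times> {0..\<lfloor>b / \<kappa>\<rfloor>}"
  proof (rule image_subsetI)
    fix m assume m: "m \<in> A"
    have "restrict (\<lambda>k. \<lfloor>m $ k\<rfloor>) (- {i, j}) \<in> ?P"
      using m A floor_in_integer_interval by (intro restrict_PiE_iff[THEN iffD2]) (auto simp: int_points_def)
    moreover have "\<lfloor>(F m - s) / \<kappa>\<rfloor> \<in> {0..\<lfloor>a / \<kappa>\<rfloor>}" "\<lfloor>(G m - t) / \<kappa>\<rfloor> \<in> {0..\<lfloor>b / \<kappa>\<rfloor>}"
      using F(1)[OF m] G(1)[OF m] \<kappa> by (auto intro!: floor_mono divide_right_mono)
    ultimately show "?g m \<in> ?P \<times> {0..\<lfloor>a / \<kappa>\<rfloor>} \<times> {0..\<lfloor>b / \<kappa>\<rfloor>}"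
      by blast
  qed
  moreover have fin: "finite ?P"
    by (intro finite_PiE) auto
  ultimately have "card A \<le> card (?P \<times> {0..\<lfloor>a / \<kappa>\<rfloor>} \<times> {0..\<lfloor>b / \<kappa>\<rfloor>})"
    by (intro card_inj_on_le) auto
  then have "real (card A) \<le> real (card (?P \<times> {0..\<lfloor>a / \<kappa>\<rfloor>} \<times> {0..\<lfloor>b / \<kappa>\<rfloor>}))"
    by simp
  also have "\<dots> = real (card {- \<lfloor>R\<rfloor>..\<lfloor>R\<rfloor>}) ^ (CARD('n) - card {i, j}) *
      real (card {0..\<lfloor>a / \<kappa>\<rfloor>}) * real (card {0..\<lfloor>b / \<kappa>\<rfloor>})"
    using fin by (simp only: card_cartesian_product card_PiE finite prod_constant Compl_eq_Diff_UNIV card_Diff_subset[OF finite subset_UNIV] of_nat_mult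
        of_nat_power mult.assoc)
  also have "\<dots> \<le> (2 * R + 1) ^ (CARD('n) - card {i, j}) * (a / \<kappa> + 1) * (b / \<kappa> + 1)"
  proof (intro mult_mono power_mono)
    show "real (card {- \<lfloor>R\<rfloor>..\<lfloor>R\<rfloor>}) \<le> 2 * R + 1"
      by (rule card_integer_interval_le[OF R])
    have "a / \<kappa> \<ge> 0" "b / \<kappa> \<ge> 0"
      using F(2) G(2) \<kappa> by auto
    then show "real (card {0..\<lfloor>a / \<kappa>\<rfloor>}) \<le> a / \<kappa> + 1" "real (card {0..\<lfloor>b / \<kappa>\<rfloor>}) \<le> b / \<kappa> + 1"
      by (simp_all add: of_nat_nat)
  qed (use R F(2) G(2) \<kappa> in auto)
  finally show ?thesis .
qed

text \<open>
  If all minors vanished, \<open>\<partial>\<^sub>x (\<omega> \<bullet> \<nabla>\<^sub>y f)\<close> would equal \<open>a \<nabla>\<^sub>x f\<close> for some \<open>a\<close>, and \<open>(-a, \<omega>)\<close> would be a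
  left null vector of the Monge-Ampere matrix.
\<close>

lemma monge_ampere_minor_nonzero:
  fixes f :: "(real^'n) \<times> (real^'n) \<Rightarrow> real"
  assumes det: "det (monge_ampere_matrix f p) \<noteq> 0"
    and \<omega>: "\<omega> \<noteq> 0" "\<omega> \<bullet> grad_y f p = 0" and u: "grad_x f p \<noteq> 0"
  obtains i j where "dx i f p * (\<Sum>k\<in>UNIV. \<omega> $ k * dx j (dy k f) p) -
      dx j f p * (\<Sum>k\<in>UNIV. \<omega> $ k * dx i (dy k f) p) \<noteq> 0"
proof (rule ccontr)
  assume "\<not> thesis"
  with that have minors: "dx i f p * (\<Sum>k\<in>UNIV. \<omega> $ k * dx j (dy k f) p) =
      dx j f p * (\<Sum>k\<in>UNIV. \<omega> $ k * dx i (dy k f) p)" for i j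
    by force
  obtain i where i: "dx i f p \<noteq> 0"
    using u by (auto simp: vec_eq_iff grad_x_def)
  \<comment> \<open>The nonzero entry \<open>dx i f p\<close> determines the factor of
    proportionality; the vanishing minors carry it over to every other column.\<close>
  define a where "a = (\<Sum>k\<in>UNIV. \<omega> $ k * dx i (dy k f) p) / dx i f p"
  have a: "(\<Sum>k\<in>UNIV. \<omega> $ k * dx j (dy k f) p) = a * dx j f p" for j
    using minors[of i j] i by (simp add: a_def field_simps)
  define w :: "real^('n option)" where "w = (\<chi> r. case r of None \<Rightarrow> - a | Some j \<Rightarrow> \<omega> $ j)"
  have sum_option: "(\<Sum>r\<in>UNIV. g r) = g None + (\<Sum>k\<in>UNIV. g (Some k))" for g :: "'n option \<Rightarrow> real"
    by (simp add: UNIV_option_conv sum.reindex)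
  have "transpose (monge_ampere_matrix f p) *v w = 0"
  proof (subst vec_eq_iff, intro allI)
    fix c :: "'n option"
    show "(transpose (monge_ampere_matrix f p) *v w) $ c = 0 $ c"
    proof (cases c)
      case None
      then show ?thesis
        using \<omega>(2) by (simp add: matrix_vector_mult_def transpose_def sum_option monge_ampere_matrix_def
            w_def inner_vec_def sum_negf mult.commute)
    next
      case (Some j)
      then show ?thesis
        using a[of j] by (simp add: matrix_vector_mult_def transpose_def sum_option monge_ampere_matrix_def
            w_def grad_x_def mult.commute)
    qed
  qed
  moreover have "\<exists>B. B ** transpose (monge_ampere_matrix f p) = mat 1"
    using det by (metis det_transpose invertible_det_nz invertible_def)
  ultimately have "w = 0"
    using matrix_left_invertible_ker by blast
  then have "\<omega> = 0"
    by (simp add: w_def vec_eq_iff) (metis option.simps(5))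
  with \<omega>(1) show False by simp
qed

section \<open>Smoothness classes and restriction to one variable or two coordinates\<close>

lemma C_class_on_Suc: "C_class_on (Suc k) f S \<Longrightarrow> open S \<Longrightarrow> C_class_on k f S"
proof (induction k arbitrary: f)
  case 0
  then show ?case
    by (auto intro!: continuous_at_imp_continuous_on differentiable_imp_continuous_within)
next
  case (Suc k)
  from Suc.prems(1) have "C_class_on (Suc k) (\<lambda>p. frechet_derivative f (at p) b) S" if "b \<in> Basis" for b
    using that by (subst (asm) C_class_on.simps(2)) blast
  with Suc show ?case
    by simp
qed

lemma C_class_on_mono: "k \<le> l \<Longrightarrow> C_class_on l f S \<Longrightarrow> open S \<Longrightarrow> C_class_on k f S"
  by (induction rule: inc_induct) (blast intro: C_class_on_Suc)+

lemma has_derivative_slice_x: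
  fixes f :: "(real^'n) \<times> (real^'n) \<Rightarrow> real"
  assumes "f differentiable (at (x, y))"
  shows "((\<lambda>x. f (x, y)) has_derivative (\<lambda>h. grad_x f (x, y) \<bullet> h)) (at x)"
proof -
  have "((\<lambda>x. (x, y)) has_derivative (\<lambda>h. (h, 0))) (at x)"
    by (auto intro!: derivative_eq_intros)
  from has_derivative_compose[OF this has_derivative_grad[OF assms]] show ?thesis
    by simp
qed

lemma has_derivative_slice_y:
  fixes f :: "(real^'n) \<times> (real^'n) \<Rightarrow> real"
  assumes "f differentiable (at (x, y))"
  shows "((\<lambda>y. f (x, y)) has_derivative (\<lambda>h. grad_y f (x, y) \<bullet> h)) (at y)"
proof -
  have "((\<lambda>y. (x, y)) has_derivative (\<lambda>h. (0, h))) (at y)"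
    by (auto intro!: derivative_eq_intros)
  from has_derivative_compose[OF this has_derivative_grad[OF assms]] show ?thesis
    by simp
qed

text \<open>Along a segment that moves only the coordinates \<open>i\<close> and \<open>j\<close>,
  only these two partial derivatives enter, both at one intermediate point. As the sum runs over the
  set \<open>{i, j}\<close>, the case \<open>i = j\<close> is the one-coordinate version with no
  double counting.\<close>

lemma mvt_two_coordinates:
  fixes F :: "real^'n \<Rightarrow> real"
  assumes "convex X" "x \<in> X" "x' \<in> X"
    and F: "\<And>x. x \<in> X \<Longrightarrow> (F has_derivative (\<lambda>h. c x \<bullet> h)) (at x)"
    and eq: "\<And>k. k \<notin> {i, j} \<Longrightarrow> x $ k = x' $ k"
  obtains \<xi> where "\<xi> \<in> X" "F x - F x' = (\<Sum>k\<in>{i, j}. c \<xi> $ k * (x $ k - x' $ k))"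
proof -
  have "closed_segment x' x \<subseteq> X"
    using assms(1-3) by (simp add: closed_segment_subset)
  then obtain \<xi> where \<xi>: "\<xi> \<in> X" "F x - F x' = c \<xi> \<bullet> (x - x')"
    using mvt_closed_segment[of x' x F "\<lambda>x h. c x \<bullet> h"] F by (metis subsetD)
  have "c \<xi> \<bullet> (x - x') = (\<Sum>k\<in>{i, j}. c \<xi> $ k * (x $ k - x' $ k))"
    unfolding inner_vec_def using eq by (intro sum.mono_neutral_cong_right) auto
  with \<xi> that show thesis
    by metis
qed

lemma int_points_coord_eq:
  "m \<in> int_points \<Longrightarrow> m' \<in> int_points \<Longrightarrow> \<bar>m $ i - m' $ i\<bar> < 1 \<Longrightarrow> m $ i = m' $ i"
  using Ints_nonzero_abs_less1[of "m $ i - m' $ i"] by (auto simp: int_points_def)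

text \<open>Split by the maximum norm \<open>k\<close>: a layer has O(k^(d-1)) points, each of norm
  at least \<open>k\<close>, so it contributes O(k^(d-2)), and there are at most \<open>R\<close>
  layers. With \<open>R = r\<close> this is the cost of summing over the differences
  \<open>h\<close>.\<close>

lemma sum_inverse_norm_int_points_le:
  fixes R :: real
  assumes R: "R \<ge> 1" and dim: "CARD('n) \<ge> 2"
  shows "(\<Sum>h\<in>{h::real^'n. h \<in> int_points \<and> (\<forall>k. \<bar>h $ k\<bar> \<le> R)} - {0}. 1 / norm h)
    \<le> 2 * 3 ^ (CARD('n) - 1) * real CARD('n) * R ^ (CARD('n) - 1)"
proof -
  let ?H = "{h::real^'n. h \<in> int_points \<and> (\<forall>k. \<bar>h $ k\<bar> \<le> R)} - {0}"
  \<comment> \<open>\<open>B i k\<close> consists of the integer points on two opposite faces of a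
    cube, where coordinate \<open>i\<close> has the maximal modulus \<open>k\<close>. Points on
    edges lie in several of these sets, which is harmless for an upper bound.\<close>
  define B where "B i k = {h::real^'n. h \<in> int_points \<and> \<bar>h $ i\<bar> = real k \<and> (\<forall>j. \<bar>h $ j\<bar> \<le> real k)}" for i k
  let ?I = "(UNIV::'n set) \<times> {1..nat \<lfloor>R\<rfloor>}"
  have fin: "finite (B i k)" for i k
    by (rule finite_int_points_cube[of _ "real k"]) (auto simp: B_def)
  have cover: "?H \<subseteq> (\<Union>(i, k)\<in>?I. B i k)"
  proof
    fix h assume h: "h \<in> ?H"
    have "Max (range (\<lambda>i. \<bar>h $ i\<bar>)) \<in> range (\<lambda>i. \<bar>h $ i\<bar>)"
      by (intro Max_in) auto
    then obtain i where "\<bar>h $ i\<bar> = Max (range (\<lambda>i. \<bar>h $ i\<bar>))"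
      by (metis imageE)
    then have i: "\<bar>h $ j\<bar> \<le> \<bar>h $ i\<bar>" for j
      by simp
    have "\<bar>h $ i\<bar> \<in> \<int>"
      using h by (auto simp: int_points_def)
    then obtain k where k: "\<bar>h $ i\<bar> = real k"
      by (metis Ints_cases abs_ge_zero nonneg_int_cases of_int_0_le_iff of_int_of_nat_eq)
    have "k \<noteq> 0"
    proof
      assume "k = 0"
      then have "h = 0"
        using i k by (simp add: vec_eq_iff)
      with h show False by simp
    qed
    moreover have "k \<le> nat \<lfloor>R\<rfloor>"
    proof (rule le_nat_floor)
      have "\<bar>h $ i\<bar> \<le> R"
        using h by blast
      with k show "real k \<le> R" by simp
    qed
    ultimately show "h \<in> (\<Union>(i, k)\<in>?I. B i k)"
      using h i k by (auto simp: B_def intro!: bexI[of _ i] exI[of _ i] bexI[of _ k])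
  qed
  have layer: "(\<Sum>h\<in>B i k. 1 / norm h) \<le> 2 * 3 ^ (CARD('n) - 1) * R ^ (CARD('n) - 2)"
    if k: "k \<in> {1..nat \<lfloor>R\<rfloor>}" for i k
  proof -
    have k1: "real k \<ge> 1" and kR: "real k \<le> R"
      using k R by (auto simp: le_nat_iff le_floor_iff)
    have "real (card (B i k)) \<le> (2 * real k + 1) ^ (CARD('n) - card {i, i}) * (2 / 2 + 1) * (0 / 2 + 1)"
    \<comment> \<open>On \<open>B i k\<close> the quotient \<open>h $ i / k\<close> is 1 or -1.
      Cells of length 2 suffice to tell these values apart, so there are at most two faces, with d-1
      free coordinates on each.\<close>
    proof (rule card_int_points_separated_le[where F = "\<lambda>h. h $ i / k" and s = "-1" and G = "\<lambda>_. 0" and t = 0])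
      fix m m' assume m: "m \<in> B i k" "m' \<in> B i k" "\<And>j. j \<notin> {i, i} \<Longrightarrow> m $ j = m' $ j"
        "\<bar>m $ i / k - m' $ i / k\<bar> < 2"
      have "\<bar>m $ i - m' $ i\<bar> < 2 * k"
        using m(4) k1 by (simp add: diff_divide_distrib[symmetric] divide_simps)
      then have "m $ i = m' $ i"
        using m(1,2) by (auto simp: B_def abs_if split: if_splits)
      with m(3) show "m = m'"
        by (metis insertE emptyE vec_eq_iff)
    qed (use k1 in \<open>auto simp: B_def abs_if divide_simps split: if_splits\<close>)
    then have card: "real (card (B i k)) \<le> 2 * (2 * real k + 1) ^ (CARD('n) - 1)"
      by simp
    have "1 / norm h \<le> 1 / k" if "h \<in> B i k" for h
      using component_le_norm_cart[of h i] that k1 by (auto simp: B_def frac_le)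
    then have "(\<Sum>h\<in>B i k. 1 / norm h) \<le> real (card (B i k)) * (1 / k)"
      by (rule sum_bounded_above)
    also have "\<dots> \<le> (2 * (3 * real k) ^ (CARD('n) - 1)) * (1 / k)"
      using k1 by (intro mult_right_mono order_trans[OF card] mult_left_mono power_mono) auto
    also have "\<dots> = 2 * 3 ^ (CARD('n) - 1) * real k ^ (CARD('n) - 2)"
    proof -
      have "CARD('n) - 1 = Suc (CARD('n) - 2)"
        using dim by simp
      then show ?thesis
        using k1 by (simp add: power_mult_distrib)
    qed
    also have "\<dots> \<le> 2 * 3 ^ (CARD('n) - 1) * R ^ (CARD('n) - 2)"
      using kR by (intro mult_left_mono power_mono) auto
    finally show ?thesis .
  qed
  have finH: "finite ?H"
    by (rule finite_int_points_cube[of _ R]) auto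
  have "(\<Sum>h\<in>?H. 1 / norm h) \<le> (\<Sum>(ik, h)\<in>(SIGMA ik:?I. B (fst ik) (snd ik)). 1 / norm h)"
  proof (rule sum_le_included[where i = snd, OF finH])
    show "finite (SIGMA ik:?I. B (fst ik) (snd ik))"
      using fin by (intro finite_SigmaI) auto
    show "\<forall>h\<in>?H. \<exists>y\<in>(SIGMA ik:?I. B (fst ik) (snd ik)). snd y = h \<and> 1 / norm h \<le> (case y of (ik, h) \<Rightarrow> 1 / norm h)"
    proof
      fix h assume "h \<in> ?H"
      then obtain i k where "(i, k) \<in> ?I" "h \<in> B i k"
        using cover by blast
      then show "\<exists>y\<in>(SIGMA ik:?I. B (fst ik) (snd ik)). snd y = h \<and> 1 / norm h \<le> (case y of (ik, h) \<Rightarrow> 1 / norm h)"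
        by (intro bexI[of _ "((i, k), h)"]) auto
    qed
  qed auto
  also have "\<dots> = (\<Sum>(i, k)\<in>?I. \<Sum>h\<in>B i k. 1 / norm h)"
    using fin by (subst sum.Sigma[symmetric]) (auto simp: split_def)
  also have "\<dots> \<le> (\<Sum>(i, k)\<in>?I. 2 * 3 ^ (CARD('n) - 1) * R ^ (CARD('n) - 2))"
    using layer by (intro sum_mono) auto
  also have "\<dots> = real CARD('n) * real (nat \<lfloor>R\<rfloor>) * (2 * 3 ^ (CARD('n) - 1) * R ^ (CARD('n) - 2))"
    by (simp add: card_cartesian_product)
  also have "\<dots> \<le> real CARD('n) * R * (2 * 3 ^ (CARD('n) - 1) * R ^ (CARD('n) - 2))"
    using R of_nat_floor[of R] by (intro mult_right_mono mult_left_mono) auto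
  also have "\<dots> = 2 * 3 ^ (CARD('n) - 1) * real CARD('n) * R ^ Suc (CARD('n) - 2)"
    by simp
  also have "Suc (CARD('n) - 2) = CARD('n) - 1"
    using dim by simp
  finally show ?thesis .
qed

section \<open>Transversal slabs\<close>

text \<open>The conditions imposed on all positive levels are gathered on the set where
  \<open>\<phi> p > 0\<close>. The number \<open>\<tau>\<close> is a lower bound for the levels
  after rescaling to the unit ball; it keeps them inside a compact set away from level zero, so that
  constants are uniform.\<close>

locale rotational_curvature =
  fixes \<phi> :: "(real^'n) \<times> (real^'n) \<Rightarrow> real" and \<tau> :: real
  assumes homogeneous: "c > 0 \<Longrightarrow> \<phi> (c *\<^sub>R p) = c * \<phi> p"
    and smooth: "C_class_on 2 \<phi> (- {0})"
    and grad_x_nonzero: "p \<in> cball 0 1 \<times> cball 0 1 \<Longrightarrow> \<phi> p > 0 \<Longrightarrow> grad_x \<phi> p \<noteq> 0"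
    and monge_ampere: "p \<in> cball 0 1 \<times> cball 0 1 \<Longrightarrow> \<phi> p > 0 \<Longrightarrow> det (monge_ampere_matrix \<phi> p) \<noteq> 0"
    and tau_pos: "\<tau> > 0"
    and dim: "CARD('n) \<ge> 2"
begin

lemma smooth_Suc: "C_class_on (Suc (Suc 0)) \<phi> (- {0})"
  using smooth by (simp add: numeral_2_eq_2)

lemma differentiable: "p \<noteq> 0 \<Longrightarrow> \<phi> differentiable (at p)"
  using smooth_Suc by (metis C_class_on.simps(2) ComplI singletonD)

lemma differentiable_dy: "p \<noteq> 0 \<Longrightarrow> dy k \<phi> differentiable (at p)"
  using C_class_on_dy[OF smooth_Suc, of k] by (metis C_class_on.simps(2) ComplI singletonD)

lemma isCont_derivatives:
  assumes "p \<noteq> 0"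
  shows "isCont (dx i \<phi>) p" "isCont (dy i \<phi>) p" "isCont (dx i (dy k \<phi>)) p" "isCont (dy i (dy k \<phi>)) p"
proof -
  have "continuous_on (- {0}) (dx i \<phi>)" "continuous_on (- {0}) (dy i \<phi>)"
    "continuous_on (- {0}) (dx i (dy k \<phi>))" "continuous_on (- {0}) (dy i (dy k \<phi>))"
    by (rule C_class_on_continuous C_class_on_dx C_class_on_dy smooth_Suc open_Compl closed_singleton)+
  with assms show "isCont (dx i \<phi>) p" "isCont (dy i \<phi>) p" "isCont (dx i (dy k \<phi>)) p"
    "isCont (dy i (dy k \<phi>)) p"
    by (simp_all add: continuous_on_eq_continuous_at open_Compl)
qed

lemma has_derivative_directional:
  assumes "(x, y) \<noteq> 0"
  shows "((\<lambda>x. w \<bullet> grad_y \<phi> (x, y)) has_derivative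
    (\<lambda>h. (\<Sum>k\<in>UNIV. w $ k *\<^sub>R grad_x (dy k \<phi>) (x, y)) \<bullet> h)) (at x)"
proof -
  have "((\<lambda>x. \<Sum>k\<in>UNIV. w $ k * dy k \<phi> (x, y)) has_derivative
      (\<lambda>h. \<Sum>k\<in>UNIV. w $ k * (grad_x (dy k \<phi>) (x, y) \<bullet> h))) (at x)"
    by (intro has_derivative_sum has_derivative_mult_right has_derivative_slice_x differentiable_dy assms)
  then show ?thesis
    by (simp add: inner_sum_left inner_vec_def[of w] grad_y_def)
qed

text \<open>Homogeneity forces \<open>\<phi> 0 = 0\<close>, so positive levels avoid the origin,
  where no smoothness is assumed.\<close>

lemma zero_if_phi_pos: "\<phi> p > 0 \<Longrightarrow> p \<noteq> 0"
  using homogeneous[of 2 0] by auto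

text \<open>Everything is evaluated at the rescaled point \<open>n /\<^sub>R Q\<close> of the unit
  ball. By homogeneity the first constraint has width \<open>a\<close> in the scale of
  \<open>n\<close>, and the second has width of order \<open>Q * \<eta>\<close>. The expected count
  is therefore Q^(d-2) times \<open>a\<close> times \<open>Q * \<eta>\<close>.\<close>

definition slab :: "real \<Rightarrow> real^'n \<Rightarrow> real^'n \<Rightarrow> real \<Rightarrow> real \<Rightarrow> real \<Rightarrow> (real^'n) set" where
  "slab Q y w t a \<eta> = {n \<in> int_points. norm n \<le> Q \<and> \<bar>\<phi> (n /\<^sub>R Q, y) - t\<bar> \<le> a / Q \<and>
     \<bar>w \<bullet> grad_y \<phi> (n /\<^sub>R Q, y)\<bar> \<le> \<eta>}"

text \<open>
  If \<open>\<omega> \<bullet> \<nabla>\<^sub>y \<phi> \<noteq> 0\<close> at the base point, \<open>\<eta>\<close> is bounded below nearby unless the slab is empty, and the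
  constraint on \<open>\<phi>\<close> alone suffices. Otherwise the Monge-Ampere condition makes \<open>x \<mapsto> (\<phi>, w \<bullet> \<nabla>\<^sub>y \<phi>)\<close>
  bi-Lipschitz in two suitable coordinates.
\<close>

lemma slab_local:
  assumes p: "p \<in> cball 0 1 \<times> cball 0 1" "\<phi> p > 0" and \<omega>: "\<omega> \<noteq> 0"
  shows "\<exists>e>0. \<exists>K. \<forall>Q y w t a \<eta>. Q \<ge> 1 \<longrightarrow> a \<ge> 1 \<longrightarrow> \<eta> > 0 \<longrightarrow> Q * \<eta> \<ge> 1 \<longrightarrow>
    real (card {n \<in> slab Q y w t a \<eta>. ((n /\<^sub>R Q, y), w) \<in> ball (p, \<omega>) e})
      \<le> K * (Q ^ (CARD('n) - 1) * a * \<eta>)"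
proof -
  let ?z = "(p, \<omega>)"
  have p0: "p \<noteq> 0"
    using zero_if_phi_pos p by blast
  \<comment> \<open>The variable \<open>z\<close> packs a point together with a direction, so that
    neighbourhoods are taken in both and one compactness argument can cover all directions.
    \<open>U\<close> and \<open>V\<close> are the derivatives in the first variable of the two
    functions that define the slab; \<open>W\<close> is the value of the second one.\<close>
  define U where "U i z = dx i \<phi> (fst z)" for i and z :: "((real^'n) \<times> (real^'n)) \<times> (real^'n)"
  define V where "V i z = (\<Sum>k\<in>UNIV. snd z $ k * dx i (dy k \<phi>) (fst z))"
    for i and z :: "((real^'n) \<times> (real^'n)) \<times> (real^'n)"
  define W where "W z = snd z \<bullet> grad_y \<phi> (fst z)" for z :: "((real^'n) \<times> (real^'n)) \<times> (real^'n)"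
  have fst_lim: "(fst \<longlongrightarrow> p) (nhds ?z)" and snd_lim: "(snd \<longlongrightarrow> \<omega>) (nhds ?z)"
    using tendsto_fst[OF filterlim_ident[of "nhds ?z"]] tendsto_snd[OF filterlim_ident[of "nhds ?z"]]
    by simp_all
  have lim: "((\<lambda>z. f (fst z)) \<longlongrightarrow> f p) (nhds ?z)" if "isCont f p" for f :: "_ \<Rightarrow> real"
    using isCont_tendsto_compose[OF that fst_lim] .
  have limU: "(U i \<longlongrightarrow> U i ?z) (nhds ?z)" for i
    unfolding U_def using lim[OF isCont_derivatives(1)[OF p0]] by simp
  have limV: "(V i \<longlongrightarrow> V i ?z) (nhds ?z)" for i
    unfolding V_def using snd_lim lim[OF isCont_derivatives(3)[OF p0]]
    by (auto intro!: tendsto_intros)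
  have limW: "(W \<longlongrightarrow> W ?z) (nhds ?z)"
    unfolding W_def inner_vec_def grad_y_def using snd_lim lim[OF isCont_derivatives(2)[OF p0]]
    by (auto intro!: tendsto_intros)
  have ev0: "eventually (\<lambda>z. fst z \<noteq> 0) (nhds ?z)"
    using tendsto_imp_eventually_ne[OF fst_lim p0] .
  \<comment> \<open>Slices of the ball at fixed \<open>y\<close> and \<open>w\<close>: being convex,
    they contain the intermediate points of the mean value theorem, so bounds valid on the ball
    apply there.\<close>
  let ?X = "\<lambda>e y w. {x. ((x, y), w) \<in> ball ?z e}"
  have convex_X: "convex (?X e y w)" for e y w
  proof (rule convexI)
    fix a b and u v :: real
    assume *: "a \<in> ?X e y w" "b \<in> ?X e y w" "0 \<le> u" "0 \<le> v" "u + v = 1"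
    have "u *\<^sub>R ((a, y), w) + v *\<^sub>R ((b, y), w) \<in> ball ?z e"
      using * by (intro convexD[OF convex_ball]) auto
    moreover have "u *\<^sub>R y + v *\<^sub>R y = y" "u *\<^sub>R w + v *\<^sub>R w = w"
      using \<open>u + v = 1\<close> by (simp_all add: scaleR_add_left[symmetric])
    ultimately show "u *\<^sub>R a + v *\<^sub>R b \<in> ?X e y w"
      by simp
  qed
  have mvt_U: "\<exists>\<xi>\<in>ball ?z e. \<phi> (n /\<^sub>R Q, y) - \<phi> (n' /\<^sub>R Q, y) =
      (\<Sum>k\<in>{i, j}. U k \<xi> * (n $ k - n' $ k) / Q)"
    if ne: "\<And>z. z \<in> ball ?z e \<Longrightarrow> fst z \<noteq> 0"
      and n: "((n /\<^sub>R Q, y), w) \<in> ball ?z e" "((n' /\<^sub>R Q, y), w) \<in> ball ?z e"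
      and eq: "\<And>k. k \<notin> {i, j} \<Longrightarrow> n $ k = n' $ k" for e y w Q n n' i j
  proof -
    have der: "((\<lambda>x. \<phi> (x, y)) has_derivative (\<lambda>h. grad_x \<phi> (x, y) \<bullet> h)) (at x)" if "x \<in> ?X e y w" for x
      using ne[of "((x, y), w)"] that by (intro has_derivative_slice_x differentiable) auto
    obtain \<xi> where "\<xi> \<in> ?X e y w" "\<phi> (n /\<^sub>R Q, y) - \<phi> (n' /\<^sub>R Q, y) =
        (\<Sum>k\<in>{i, j}. grad_x \<phi> (\<xi>, y) $ k * ((n /\<^sub>R Q) $ k - (n' /\<^sub>R Q) $ k))"
      by (rule mvt_two_coordinates[of "?X e y w" "n /\<^sub>R Q" "n' /\<^sub>R Q" "\<lambda>x. \<phi> (x, y)"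
            "\<lambda>x. grad_x \<phi> (x, y)" i j]) (use convex_X n eq der in auto)
    then show ?thesis
      by (intro bexI[of _ "((\<xi>, y), w)"]) (auto simp: U_def grad_x_def divide_inverse algebra_simps)
  qed
  have mvt_V: "\<exists>\<xi>\<in>ball ?z e. w \<bullet> grad_y \<phi> (n /\<^sub>R Q, y) - w \<bullet> grad_y \<phi> (n' /\<^sub>R Q, y) =
      (\<Sum>k\<in>{i, j}. V k \<xi> * (n $ k - n' $ k) / Q)"
    if ne: "\<And>z. z \<in> ball ?z e \<Longrightarrow> fst z \<noteq> 0"
      and n: "((n /\<^sub>R Q, y), w) \<in> ball ?z e" "((n' /\<^sub>R Q, y), w) \<in> ball ?z e"
      and eq: "\<And>k. k \<notin> {i, j} \<Longrightarrow> n $ k = n' $ k" for e y w Q n n' i j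
  proof -
    let ?c = "\<lambda>x. \<Sum>k\<in>UNIV. w $ k *\<^sub>R grad_x (dy k \<phi>) (x, y)"
    have der: "((\<lambda>x. w \<bullet> grad_y \<phi> (x, y)) has_derivative (\<lambda>h. ?c x \<bullet> h)) (at x)" if "x \<in> ?X e y w" for x
      using ne[of "((x, y), w)"] that by (intro has_derivative_directional) auto
    obtain \<xi> where "\<xi> \<in> ?X e y w" "w \<bullet> grad_y \<phi> (n /\<^sub>R Q, y) - w \<bullet> grad_y \<phi> (n' /\<^sub>R Q, y) =
        (\<Sum>k\<in>{i, j}. ?c \<xi> $ k * ((n /\<^sub>R Q) $ k - (n' /\<^sub>R Q) $ k))"
      by (rule mvt_two_coordinates[of "?X e y w" "n /\<^sub>R Q" "n' /\<^sub>R Q"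
            "\<lambda>x. w \<bullet> grad_y \<phi> (x, y)" ?c i j]) (use convex_X n eq der in auto)
    moreover have "?c \<xi> $ k = V k ((\<xi>, y), w)" for k
      by (simp add: V_def grad_x_def)
    moreover have "V k z * ((n /\<^sub>R Q) $ k - (n' /\<^sub>R Q) $ k) = V k z * (n $ k - n' $ k) / Q" for k z
      by (simp add: divide_inverse algebra_simps)
    ultimately show ?thesis
      by (intro bexI[of _ "((\<xi>, y), w)"]) auto
  qed
  have slab_coord: "\<bar>m $ k\<bar> \<le> Q" if "m \<in> slab Q y w t a \<eta>" for m k Q y w t a \<eta>
    using that component_le_norm_cart[of m k] by (auto simp: slab_def)
  have abs_bounds: "\<bar>x - t\<bar> \<le> b \<Longrightarrow> t - b \<le> x \<and> x \<le> (t - b) + 2 * b" for x t b :: real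
    by (auto simp: abs_le_iff)
  show ?thesis
  proof (cases "W ?z = 0")
    case False
    obtain i where i: "U i ?z \<noteq> 0"
      using grad_x_nonzero[OF p] by (auto simp: vec_eq_iff grad_x_def U_def)
    define c where "c = min \<bar>W ?z\<bar> \<bar>U i ?z\<bar> / 2"
    have c: "c > 0" "c < \<bar>W ?z\<bar>" "c < \<bar>U i ?z\<bar>"
      using False i by (auto simp: c_def min_def)
    have "eventually (\<lambda>z. c < \<bar>W z\<bar> \<and> c < \<bar>U i z\<bar> \<and> fst z \<noteq> 0) (nhds ?z)"
      using order_tendstoD(1)[OF tendsto_rabs[OF limW] c(2)]
        order_tendstoD(1)[OF tendsto_rabs[OF limU] c(3)] ev0
      by eventually_elim auto
    then obtain e where e: "e > 0" "\<And>z. z \<in> ball ?z e \<Longrightarrow> c < \<bar>W z\<bar> \<and> c < \<bar>U i z\<bar> \<and> fst z \<noteq> 0"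
      unfolding eventually_nhds_metric by (auto simp: dist_commute)
    define K where "K = 3 ^ (CARD('n) - 1) * (2 / c + 1) / c"
    have "real (card {n \<in> slab Q y w t a \<eta>. ((n /\<^sub>R Q, y), w) \<in> ball ?z e}) \<le> K * (Q ^ (CARD('n) - 1) * a * \<eta>)"
      (is "real (card ?A) \<le> _")
      if Q: "Q \<ge> 1" and a: "a \<ge> 1" and \<eta>: "\<eta> > 0" for Q y w t a \<eta>
    proof (cases "?A = {}")
      case True
      then show ?thesis
        using Q a \<eta> c by (simp only: card.empty) (simp add: K_def)
    next
      case False
      then obtain n where "n \<in> ?A" by blast
      then have \<eta>c: "c \<le> \<eta>"
        using e(2)[of "((n /\<^sub>R Q, y), w)"] by (auto simp: slab_def W_def)
      \<comment> \<open>A unit step in coordinate \<open>i\<close> is a step \<open>1 / Q\<close>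
        after rescaling. As the partial derivative exceeds \<open>c\<close> in modulus on the ball,
        such a step moves \<open>\<phi>\<close> by more than \<open>c / Q\<close>, hence cells of
        that length separate integer points.\<close>
      have "real (card ?A) \<le> (2 * Q + 1) ^ (CARD('n) - card {i, i}) * (2 * (a / Q) / (c / Q) + 1) * (0 / (c / Q) + 1)"
      proof (rule card_int_points_separated_le[where F = "\<lambda>n. \<phi> (n /\<^sub>R Q, y)" and G = "\<lambda>_. 0" and t = 0
            and s = "t - a / Q"])
        fix m m' assume m: "m \<in> ?A" "m' \<in> ?A" "\<And>k. k \<notin> {i, i} \<Longrightarrow> m $ k = m' $ k"
          "\<bar>\<phi> (m /\<^sub>R Q, y) - \<phi> (m' /\<^sub>R Q, y)\<bar> < c / Q"
        then obtain \<xi> where \<xi>: "\<xi> \<in> ball ?z e"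
          "\<phi> (m /\<^sub>R Q, y) - \<phi> (m' /\<^sub>R Q, y) = U i \<xi> * (m $ i - m' $ i) / Q"
          using mvt_U[where e = e and n = m and n' = m' and Q = Q and y = y and w = w and i = i and j = i] e(2) by auto
        have "\<bar>U i \<xi>\<bar> * \<bar>m $ i - m' $ i\<bar> < c"
          using m(4) Q unfolding \<xi>(2) by (simp add: abs_mult divide_simps)
        then have "\<bar>m $ i - m' $ i\<bar> < 1"
          using e(2)[OF \<xi>(1)] c(1) mult_mono[of c "\<bar>U i \<xi>\<bar>" 1 "\<bar>m $ i - m' $ i\<bar>"] by fastforce
        then have "m $ i = m' $ i"
          using m(1,2) by (intro int_points_coord_eq) (auto simp: slab_def)
        with m(3) show "m = m'"
          by (metis insertE emptyE vec_eq_iff)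
      next
        show "\<bar>m $ k\<bar> \<le> Q" if "m \<in> ?A" for m k
          using that slab_coord by blast
        show "t - a / Q \<le> \<phi> (m /\<^sub>R Q, y) \<and> \<phi> (m /\<^sub>R Q, y) \<le> t - a / Q + 2 * (a / Q)" if "m \<in> ?A" for m
          using that by (intro abs_bounds) (simp add: slab_def)
      qed (use Q a c in \<open>auto simp: slab_def\<close>)
      also have "\<dots> = (2 * Q + 1) ^ (CARD('n) - 1) * (2 * a / c + 1)"
        using Q by simp
      also have "\<dots> \<le> (3 * Q) ^ (CARD('n) - 1) * ((2 / c + 1) * a)"
        using Q a c by (intro mult_mono power_mono) (auto simp: algebra_simps)
      also have "\<dots> \<le> (3 * Q) ^ (CARD('n) - 1) * ((2 / c + 1) * a) * (\<eta> / c)"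
        using Q a c \<eta>c mult_left_mono[of 1 "\<eta> / c" "(3 * Q) ^ (CARD('n) - 1) * ((2 / c + 1) * a)"]
        by simp
      also have "\<dots> = K * (Q ^ (CARD('n) - 1) * a * \<eta>)"
        by (simp add: K_def power_mult_distrib)
      finally show ?thesis .
    qed
    with e(1) show ?thesis
      by blast
  next
    case True
    then obtain i j where ij: "U i ?z * V j ?z - U j ?z * V i ?z \<noteq> 0"
      using monge_ampere_minor_nonzero[OF monge_ampere[OF p] \<omega> _ grad_x_nonzero[OF p]]
      unfolding U_def V_def W_def by auto
    define c where "c = \<bar>U i ?z * V j ?z - U j ?z * V i ?z\<bar> / 2"
    have c: "c > 0" "c < \<bar>U i ?z * V j ?z - U j ?z * V i ?z\<bar>"
      using ij by (auto simp: c_def)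
    have "i \<noteq> j"
      using ij by auto
    then have card2: "card {i, j} = 2" "CARD('n) \<ge> 2"
      using card_mono[of UNIV "{i, j}"] by auto
    define M where "M = \<bar>U i ?z\<bar> + \<bar>U j ?z\<bar> + \<bar>V i ?z\<bar> + \<bar>V j ?z\<bar> + 1"
    have M: "M > 0" "\<bar>U i ?z\<bar> < M" "\<bar>U j ?z\<bar> < M" "\<bar>V i ?z\<bar> < M" "\<bar>V j ?z\<bar> < M"
      by (auto simp: M_def)
    \<comment> \<open>The mean value theorem yields different intermediate points for the two
      functions. The minor must therefore stay away from zero with its first row taken at
      \<open>z\<close> and its second row at an independent \<open>z'\<close>, which is a limit
      along the product filter.\<close>
    let ?N = "nhds ?z \<times>\<^sub>F nhds ?z"
    have l1: "((\<lambda>q. U k (fst q)) \<longlongrightarrow> U k ?z) ?N" for k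
      by (rule filterlim_compose[OF limU filterlim_fst])
    have l2: "((\<lambda>q. V k (snd q)) \<longlongrightarrow> V k ?z) ?N" for k
      by (rule filterlim_compose[OF limV filterlim_snd])
    have "((\<lambda>q. \<bar>U i (fst q) * V j (snd q) - U j (fst q) * V i (snd q)\<bar>) \<longlongrightarrow>
        \<bar>U i ?z * V j ?z - U j ?z * V i ?z\<bar>) ?N"
      by (intro tendsto_intros l1 l2)
    from order_tendstoD(1)[OF this c(2)] obtain P where P: "eventually P (nhds ?z)"
      "\<And>z z'. P z \<Longrightarrow> P z' \<Longrightarrow> c < \<bar>U i z * V j z' - U j z * V i z'\<bar>"
      unfolding eventually_prod_same by auto
    have "eventually (\<lambda>z. P z \<and> \<bar>U i z\<bar> < M \<and> \<bar>U j z\<bar> < M \<and> \<bar>V i z\<bar> < M \<and> \<bar>V j z\<bar> < M \<and> fst z \<noteq> 0) (nhds ?z)"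
      using P(1) order_tendstoD(2)[OF tendsto_rabs[OF limU] M(2)]
        order_tendstoD(2)[OF tendsto_rabs[OF limU] M(3)]
        order_tendstoD(2)[OF tendsto_rabs[OF limV] M(4)]
        order_tendstoD(2)[OF tendsto_rabs[OF limV] M(5)] ev0
      by eventually_elim auto
    then obtain e where e: "e > 0" "\<And>z. z \<in> ball ?z e \<Longrightarrow>
        P z \<and> \<bar>U i z\<bar> < M \<and> \<bar>U j z\<bar> < M \<and> \<bar>V i z\<bar> < M \<and> \<bar>V j z\<bar> < M \<and> fst z \<noteq> 0"
      unfolding eventually_nhds_metric by (auto simp: dist_commute)
    define K where "K = 3 ^ (CARD('n) - 2) * (4 * M / c + 1) ^ 2"
    have "real (card {n \<in> slab Q y w t a \<eta>. ((n /\<^sub>R Q, y), w) \<in> ball ?z e}) \<le> K * (Q ^ (CARD('n) - 1) * a * \<eta>)"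
      (is "real (card ?A) \<le> _")
      if Q: "Q \<ge> 1" and a: "a \<ge> 1" and \<eta>: "\<eta> > 0" and Q\<eta>: "Q * \<eta> \<ge> 1" for Q y w t a \<eta>
    proof -
      \<comment> \<open>Fitted to Cramer's rule below: after multiplication by \<open>Q\<close> both
        increments are less than \<open>c / (2 * M)\<close>. With entries below \<open>M\<close>,
        the two terms of each numerator add up to at most \<open>c\<close>, while the determinant
        exceeds \<open>c\<close>.\<close>
      define \<kappa> where "\<kappa> = c / (2 * M * Q)"
      have \<kappa>: "\<kappa> > 0"
        using c M Q by (simp add: \<kappa>_def)
      have "real (card ?A) \<le> (2 * Q + 1) ^ (CARD('n) - card {i, j}) * (2 * (a / Q) / \<kappa> + 1) * (2 * \<eta> / \<kappa> + 1)"
      proof (rule card_int_points_separated_le[where F = "\<lambda>n. \<phi> (n /\<^sub>R Q, y)"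
            and G = "\<lambda>n. w \<bullet> grad_y \<phi> (n /\<^sub>R Q, y)" and t = "- \<eta>" and s = "t - a / Q"])
        fix m m' assume m: "m \<in> ?A" "m' \<in> ?A" "\<And>k. k \<notin> {i, j} \<Longrightarrow> m $ k = m' $ k"
          "\<bar>\<phi> (m /\<^sub>R Q, y) - \<phi> (m' /\<^sub>R Q, y)\<bar> < \<kappa>"
          "\<bar>w \<bullet> grad_y \<phi> (m /\<^sub>R Q, y) - w \<bullet> grad_y \<phi> (m' /\<^sub>R Q, y)\<bar> < \<kappa>"
        let ?\<Delta> = "\<lambda>k. m $ k - m' $ k"
        obtain z where z: "z \<in> ball ?z e"
          "\<phi> (m /\<^sub>R Q, y) - \<phi> (m' /\<^sub>R Q, y) = (\<Sum>k\<in>{i, j}. U k z * ?\<Delta> k / Q)"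
          using mvt_U[where e = e and n = m and n' = m' and Q = Q and y = y and w = w and i = i and j = j] e(2) m(1-3) by blast
        obtain z' where z': "z' \<in> ball ?z e"
          "w \<bullet> grad_y \<phi> (m /\<^sub>R Q, y) - w \<bullet> grad_y \<phi> (m' /\<^sub>R Q, y) = (\<Sum>k\<in>{i, j}. V k z' * ?\<Delta> k / Q)"
          using mvt_V[where e = e and n = m and n' = m' and Q = Q and y = y and w = w and i = i and j = j] e(2) m(1-3) by blast
        define f where "f = U i z * ?\<Delta> i + U j z * ?\<Delta> j"
        define g where "g = V i z' * ?\<Delta> i + V j z' * ?\<Delta> j"
        define D where "D = U i z * V j z' - U j z * V i z'"
        have \<kappa>Q: "\<kappa> * Q = c / (2 * M)"
          using Q by (simp add: \<kappa>_def)
        have fg: "\<bar>f\<bar> < c / (2 * M)" "\<bar>g\<bar> < c / (2 * M)"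
          using m(4,5) Q \<open>i \<noteq> j\<close> unfolding z(2) z'(2) \<kappa>Q[symmetric]
          by (simp_all add: f_def g_def add_divide_distrib[symmetric] divide_simps)
        have D: "c < \<bar>D\<bar>"
          unfolding D_def using P(2) e(2) z(1) z'(1) by blast
        \<comment> \<open>This is Cramer's rule for the two unknown coordinate differences; it is
          applied once with the coefficients for coordinate \<open>i\<close> and once for coordinate
          \<open>j\<close>. Integers differing by less than 1 then coincide.\<close>
        have small: "\<bar>x\<bar> < 1" if "D * x = u * f - v * g" "\<bar>u\<bar> < M" "\<bar>v\<bar> < M" for x u v
        proof -
          have "\<bar>u * f\<bar> \<le> M * (c / (2 * M))" "\<bar>v * g\<bar> \<le> M * (c / (2 * M))"
            unfolding abs_mult using that fg M by (intro mult_mono; simp)+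
          then have "\<bar>D * x\<bar> \<le> c"
            using M abs_triangle_ineq4[of "u * f" "v * g"] unfolding that(1) by simp
          moreover have "\<bar>D\<bar> * 1 \<le> \<bar>D\<bar> * \<bar>x\<bar>" if "\<not> \<bar>x\<bar> < 1"
            using that by (intro mult_left_mono) auto
          ultimately show ?thesis
            using D unfolding abs_mult by linarith
        qed
        have "\<bar>?\<Delta> i\<bar> < 1"
          by (rule small[of _ "V j z'" "U j z"])
            (use e(2)[OF z(1)] e(2)[OF z'(1)] in \<open>auto simp: D_def f_def g_def algebra_simps\<close>)
        moreover have "\<bar>?\<Delta> j\<bar> < 1"
          by (rule small[of _ "- V i z'" "- U i z"])
            (use e(2)[OF z(1)] e(2)[OF z'(1)] in \<open>auto simp: D_def f_def g_def algebra_simps\<close>)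
        ultimately have "m $ i = m' $ i" "m $ j = m' $ j"
          using m(1,2) by (auto intro!: int_points_coord_eq simp: slab_def)
        with m(3) show "m = m'"
          by (metis insertE singletonD vec_eq_iff)
      next
        show "\<bar>m $ k\<bar> \<le> Q" if "m \<in> ?A" for m k
          using that slab_coord by blast
        show "t - a / Q \<le> \<phi> (m /\<^sub>R Q, y) \<and> \<phi> (m /\<^sub>R Q, y) \<le> t - a / Q + 2 * (a / Q)" if "m \<in> ?A" for m
          using that by (intro abs_bounds) (simp add: slab_def)
        show "- \<eta> \<le> w \<bullet> grad_y \<phi> (m /\<^sub>R Q, y) \<and> w \<bullet> grad_y \<phi> (m /\<^sub>R Q, y) \<le> - \<eta> + 2 * \<eta>" if "m \<in> ?A" for m
          using that by (auto simp: slab_def abs_le_iff)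
      qed (use Q a \<eta> \<kappa> in \<open>auto simp: slab_def\<close>)
      also have "\<dots> = (2 * Q + 1) ^ (CARD('n) - 2) * (4 * M / c * a + 1) * (4 * M / c * (Q * \<eta>) + 1)"
        using Q M c by (simp add: card2 \<kappa>_def field_simps)
      \<comment> \<open>The lower bounds \<open>a \<ge> 1\<close> and
        \<open>Q * \<eta> \<ge> 1\<close> absorb the summands 1 that come from rounding up the
        number of cells.\<close>
      also have "\<dots> \<le> (3 * Q) ^ (CARD('n) - 2) * ((4 * M / c + 1) * a) * ((4 * M / c + 1) * (Q * \<eta>))"
        using Q a \<eta> Q\<eta> c M by (intro mult_mono power_mono) (auto simp: algebra_simps)
      also have "\<dots> = K * (Q ^ (Suc (CARD('n) - 2)) * a * \<eta>)"
        by (simp add: K_def power_mult_distrib power2_eq_square)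
      also have "Suc (CARD('n) - 2) = CARD('n) - 1"
        using card2(2) by simp
      finally show ?thesis .
    qed
    with e(1) show ?thesis
      by blast
  qed
qed

section \<open>Compactness of superlevel sets and uniform constants\<close>

lemma continuous_on_phi: "continuous_on (- {0}) \<phi>"
  by (rule C_class_on_continuous[OF smooth]) (simp add: open_Compl)

text \<open>By homogeneity \<open>\<phi> p\<close> is \<open>norm p\<close> times a value on the
  unit sphere, and \<open>\<phi>\<close> is bounded there by compactness.\<close>

lemma superlevel_norm_ge:
  assumes "s > 0"
  shows "\<exists>c>0. \<forall>p. \<phi> p \<ge> s \<longrightarrow> norm p \<ge> c"
proof -
  have "compact (\<phi> ` sphere 0 1)"
    by (intro compact_continuous_image continuous_on_subset[OF continuous_on_phi]) auto
  then obtain B where "\<forall>x\<in>\<phi> ` sphere 0 1. norm x \<le> B"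
    using compact_imp_bounded bounded_iff by metis
  then have B: "\<bar>\<phi> p\<bar> \<le> B" if "norm p = 1" for p
    using that by simp
  have "norm p \<ge> s / (\<bar>B\<bar> + 1)" if "\<phi> p \<ge> s" for p
  proof -
    have p: "norm p > 0"
      using zero_if_phi_pos[of p] that assms by auto
    have "\<phi> p = norm p * \<phi> (p /\<^sub>R norm p)"
      using homogeneous[of "norm p" "p /\<^sub>R norm p"] p by simp
    also have "\<dots> \<le> norm p * (\<bar>B\<bar> + 1)"
      using B[of "p /\<^sub>R norm p"] p by (intro mult_left_mono) auto
    finally show ?thesis
      using that by (simp add: divide_le_eq)
  qed
  with assms show ?thesis
    by (intro exI[of _ "s / (\<bar>B\<bar> + 1)"]) auto
qed

text \<open>A ball around the origin is removed first, at no loss by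
  \<open>superlevel_norm_ge\<close>. What remains is compact and carries a continuous
  \<open>\<phi>\<close>, so the superlevel set is closed in it.\<close>

lemma compact_superlevel:
  assumes "s > 0"
  shows "compact {p \<in> cball 0 1 \<times> cball 0 1. \<phi> p \<ge> s}"
proof -
  obtain c where c: "c > 0" "\<And>p. \<phi> p \<ge> s \<Longrightarrow> norm p \<ge> c"
    using superlevel_norm_ge[OF assms] by blast
  let ?S = "cball 0 1 \<times> cball 0 1 \<inter> {p :: (real^'n) \<times> (real^'n). norm p \<ge> c}"
  have "compact ?S"
    by (intro compact_Int_closed compact_Times compact_cball closed_Collect_le continuous_intros)
  moreover have "continuous_on ?S \<phi>"
    using c(1) by (intro continuous_on_subset[OF continuous_on_phi]) auto
  ultimately have "compact (?S \<inter> (?S \<inter> \<phi> -` {s..}))"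
    by (intro compact_Int_closed[of ?S] continuous_closed_preimage compact_imp_closed[of ?S]) auto
  moreover have "?S \<inter> (?S \<inter> \<phi> -` {s..}) = {p \<in> cball 0 1 \<times> cball 0 1. \<phi> p \<ge> s}"
    using c(2) by auto
  ultimately show ?thesis
    by simp
qed

lemma finite_slab: "finite (slab Q y w t a \<eta>)"
proof (rule finite_int_points_cube[of _ Q])
  show "\<bar>m $ k\<bar> \<le> Q" if "m \<in> slab Q y w t a \<eta>" for m k
    using that component_le_norm_cart[of m k] by (auto simp: slab_def)
qed (auto simp: slab_def)

text \<open>Finitely many of the balls from \<open>slab_local\<close> cover the compact set of
  points of level at least \<open>s\<close> paired with unit directions. Adding their constants
  makes the bound uniform in \<open>y\<close>, \<open>w\<close> and \<open>t\<close>.\<close>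

lemma slab_card_le:
  assumes s: "s > 0"
  obtains K where "K > 0" "\<And>Q y w t a \<eta>. \<lbrakk>Q \<ge> 1; a \<ge> 1; \<eta> > 0; Q * \<eta> \<ge> 1; norm y \<le> 1; norm w = 1\<rbrakk> \<Longrightarrow>
    real (card {n \<in> slab Q y w t a \<eta>. \<phi> (n /\<^sub>R Q, y) \<ge> s}) \<le> K * (Q ^ (CARD('n) - 1) * a * \<eta>)"
proof -
  let ?P = "{p \<in> cball 0 1 \<times> cball 0 1. \<phi> p \<ge> s}"
  let ?Z = "?P \<times> sphere (0 :: real^'n) 1"
  define good where "good z e K \<longleftrightarrow> (\<forall>Q y w t a \<eta>. Q \<ge> 1 \<longrightarrow> a \<ge> 1 \<longrightarrow> \<eta> > 0 \<longrightarrow> Q * \<eta> \<ge> 1 \<longrightarrow>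
      real (card {n \<in> slab Q y w t a \<eta>. ((n /\<^sub>R Q, y), w) \<in> ball z e}) \<le> K * (Q ^ (CARD('n) - 1) * a * \<eta>))"
    for z e K
  have "\<exists>e>0. \<exists>K. good z e K" if "z \<in> ?Z" for z
  proof -
    have "fst z \<in> cball 0 1 \<times> cball 0 1" "\<phi> (fst z) > 0" "snd z \<noteq> 0"
      using that s by auto
    from slab_local[OF this] show ?thesis
      unfolding good_def prod.collapse .
  qed
  then have "\<forall>z\<in>?Z. \<exists>eK. fst eK > 0 \<and> good z (fst eK) (snd eK)"
    by auto
  from bchoice[OF this] obtain eK where eK: "\<forall>z\<in>?Z. fst (eK z) > 0 \<and> good z (fst (eK z)) (snd (eK z))" ..
  define e where "e z = fst (eK z)" for z
  define K where "K z = snd (eK z)" for z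
  have e: "e z > 0" and "good z (e z) (K z)" if "z \<in> ?Z" for z
    unfolding e_def K_def using bspec[OF eK that] by blast+
  then have K: "real (card {n \<in> slab Q y w t a \<eta>. ((n /\<^sub>R Q, y), w) \<in> ball z (e z)}) \<le> K z * (Q ^ (CARD('n) - 1) * a * \<eta>)"
    if "z \<in> ?Z" "Q \<ge> 1" "a \<ge> 1" "\<eta> > 0" "Q * \<eta> \<ge> 1" for z Q y w t a \<eta>
    using that unfolding good_def by blast
  have cover: "?Z \<subseteq> (\<Union>z\<in>?Z. ball z (e z))"
  proof
    fix z assume "z \<in> ?Z"
    then show "z \<in> (\<Union>z\<in>?Z. ball z (e z))"
      by (rule UN_I) (simp only: centre_in_ball e[OF \<open>z \<in> ?Z\<close>])
  qed
  have compact: "compact ?Z"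
    by (intro compact_Times compact_superlevel s) simp
  obtain D where D: "D \<subseteq> ?Z" "finite D" "?Z \<subseteq> (\<Union>z\<in>D. ball z (e z))"
    by (rule compactE_image[OF compact open_ball cover]) (rule that; assumption)
  \<comment> \<open>The local constants carry no sign, hence the absolute values; the summand 1
    keeps the total positive even if \<open>D\<close> is empty.\<close>
  show thesis
  proof (rule that[of "(\<Sum>z\<in>D. \<bar>K z\<bar>) + 1"])
    show "(\<Sum>z\<in>D. \<bar>K z\<bar>) + 1 > 0"
      by (intro add_nonneg_pos sum_nonneg) auto
    fix Q t a \<eta> :: real and y w :: "real^'n"
    assume *: "Q \<ge> 1" "a \<ge> 1" "\<eta> > 0" "Q * \<eta> \<ge> 1" "norm y \<le> 1" "norm w = 1"
    let ?A = "\<lambda>z. {n \<in> slab Q y w t a \<eta>. ((n /\<^sub>R Q, y), w) \<in> ball z (e z)}"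
    let ?b = "Q ^ (CARD('n) - 1) * a * \<eta>"
    have "{n \<in> slab Q y w t a \<eta>. \<phi> (n /\<^sub>R Q, y) \<ge> s} \<subseteq> (\<Union>z\<in>D. ?A z)"
    proof
      fix n assume n: "n \<in> {n \<in> slab Q y w t a \<eta>. \<phi> (n /\<^sub>R Q, y) \<ge> s}"
      then have "norm (n /\<^sub>R Q) \<le> 1"
        using *(1) by (simp add: slab_def divide_simps)
      then have "((n /\<^sub>R Q, y), w) \<in> ?Z"
        using n * by simp
      then show "n \<in> (\<Union>z\<in>D. ?A z)"
        using D(3) n by blast
    qed
    then have "card {n \<in> slab Q y w t a \<eta>. \<phi> (n /\<^sub>R Q, y) \<ge> s} \<le> card (\<Union>z\<in>D. ?A z)"
      using D(2) finite_slab by (intro card_mono) auto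
    also have "\<dots> \<le> (\<Sum>z\<in>D. card (?A z))"
      by (rule card_UN_le[OF D(2)])
    finally have "real (card {n \<in> slab Q y w t a \<eta>. \<phi> (n /\<^sub>R Q, y) \<ge> s}) \<le> (\<Sum>z\<in>D. real (card (?A z)))"
      by (simp only: of_nat_sum[symmetric] of_nat_le_iff)
    also have "\<dots> \<le> (\<Sum>z\<in>D. \<bar>K z\<bar> * ?b)"
    proof (rule sum_mono)
      fix z assume "z \<in> D"
      then have "real (card (?A z)) \<le> K z * ?b"
        using D(1) * by (intro K) auto
      also have "\<dots> \<le> \<bar>K z\<bar> * ?b"
        using * by (intro mult_right_mono) auto
      finally show "real (card (?A z)) \<le> \<bar>K z\<bar> * ?b" .
    qed
    also have "\<dots> \<le> ((\<Sum>z\<in>D. \<bar>K z\<bar>) + 1) * ?b"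
      using * by (simp add: sum_distrib_right[symmetric] distrib_right)
    finally show "real (card {n \<in> slab Q y w t a \<eta>. \<phi> (n /\<^sub>R Q, y) \<ge> s}) \<le> ((\<Sum>z\<in>D. \<bar>K z\<bar>) + 1) * ?b" .
  qed
qed

text \<open>The last estimate compares two points near \<open>y0\<close> with the gradient at
  \<open>y0\<close> itself, so the linear condition obtained from two admissible \<open>m\<close>
  depends only on \<open>n\<close> and on their difference. It follows from the mean value theorem,
  at the price of moving the gradient over a distance \<open>u\<close>.\<close>

lemma taylor_in_y:
  assumes s: "s > 0"
  obtains M \<rho> where "M \<ge> 1" "\<rho> > 0"
    "\<And>x y. \<lbrakk>norm x \<le> 1; norm y \<le> 1; \<phi> (x, y) \<ge> s\<rbrakk> \<Longrightarrow> norm (grad_y \<phi> (x, y)) \<le> M"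
    "\<And>x y0 y. \<lbrakk>norm x \<le> 1; norm y0 \<le> 1; \<phi> (x, y0) \<ge> s; norm (y - y0) \<le> \<rho>\<rbrakk> \<Longrightarrow>
      \<bar>\<phi> (x, y) - \<phi> (x, y0)\<bar> \<le> M * norm (y - y0)"
    "\<And>x y0 y y' u. \<lbrakk>norm x \<le> 1; norm y0 \<le> 1; \<phi> (x, y0) \<ge> s; norm (y - y0) \<le> u; norm (y' - y0) \<le> u; u \<le> \<rho>\<rbrakk> \<Longrightarrow>
      \<bar>\<phi> (x, y) - \<phi> (x, y') - (y - y') \<bullet> grad_y \<phi> (x, y0)\<bar> \<le> M * (norm (y - y') * u)"
proof -
  obtain c where c: "c > 0" "\<And>p. \<phi> p \<ge> s \<Longrightarrow> norm p \<ge> c"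
    using superlevel_norm_ge[OF s] by blast
  \<comment> \<open>The base point \<open>(x, y0)\<close> has norm between \<open>c\<close> and 2. A
    move by at most \<open>\<rho>\<close> in the second variable keeps the norm between
    \<open>c / 2\<close> and 3, even where \<open>y\<close> leaves the unit ball, so all derivatives
    are bounded on the compact set \<open>?N\<close>.\<close>
  define \<rho> where "\<rho> = min (c / 2) 1"
  have \<rho>: "\<rho> > 0" "\<rho> \<le> c / 2" "\<rho> \<le> 1"
    using c(1) by (auto simp: \<rho>_def)
  let ?N = "cball 0 3 \<inter> {p :: (real^'n) \<times> (real^'n). norm p \<ge> c / 2}"
  have N: "compact ?N"
    by (intro compact_Int_closed compact_cball closed_Collect_le continuous_intros)
  have nz: "p \<noteq> 0" if "p \<in> ?N" for p
    using that c(1) by auto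
  have bdd: "\<exists>B. \<forall>p\<in>?N. \<bar>f p\<bar> \<le> B" if "\<And>p. p \<noteq> 0 \<Longrightarrow> isCont f p" for f :: "_ \<Rightarrow> real"
  proof -
    have "continuous_on ?N f"
      using that nz by (intro continuous_at_imp_continuous_on) blast
    from compact_imp_bounded[OF compact_continuous_image[OF this N]] show ?thesis
      by (auto simp: bounded_iff)
  qed
  have "\<exists>B1. \<forall>j. \<forall>p\<in>?N. \<bar>dy j \<phi> p\<bar> \<le> B1 j"
    by (intro choice allI bdd isCont_derivatives)
  then obtain B1 where B1: "\<And>j p. p \<in> ?N \<Longrightarrow> \<bar>dy j \<phi> p\<bar> \<le> B1 j"
    by blast
  have "\<exists>B2. \<forall>ij. \<forall>p\<in>?N. \<bar>dy (fst ij) (dy (snd ij) \<phi>) p\<bar> \<le> B2 ij"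
    by (intro choice allI bdd isCont_derivatives)
  then obtain B2 where B2: "\<And>i j p. p \<in> ?N \<Longrightarrow> \<bar>dy i (dy j \<phi>) p\<bar> \<le> B2 (i, j)"
    by fastforce
  define M where "M = (\<Sum>j\<in>UNIV. \<bar>B1 j\<bar>) + (\<Sum>j\<in>UNIV. \<Sum>i\<in>UNIV. \<bar>B2 (i, j)\<bar>) + 1"
  have pos: "(\<Sum>j\<in>UNIV. \<bar>B1 j\<bar>) \<ge> 0" "(\<Sum>j\<in>UNIV. \<Sum>i\<in>UNIV. \<bar>B2 (i, j)\<bar>) \<ge> 0"
    by (intro sum_nonneg abs_ge_zero)+
  have grad_le: "norm (grad_y \<phi> p) \<le> M" if p: "p \<in> ?N" for p
  proof -
    have "norm (grad_y \<phi> p) \<le> (\<Sum>j\<in>UNIV. \<bar>grad_y \<phi> p $ j\<bar>)"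
      by (rule norm_le_l1_cart)
    also have "\<dots> \<le> (\<Sum>j\<in>UNIV. \<bar>B1 j\<bar>)"
      unfolding grad_y_def vec_lambda_beta by (intro sum_mono order_trans[OF B1[OF p] abs_ge_self])
    finally show ?thesis
      using pos by (simp add: M_def)
  qed
  have inN: "(x, \<xi>) \<in> ?N" if "norm x \<le> 1" "norm y0 \<le> 1" "\<phi> (x, y0) \<ge> s" "norm (\<xi> - y0) \<le> \<rho>" for x y0 \<xi>
  proof -
    have "norm (x, y0) \<ge> c" "norm (x, y0) \<le> 2"
      using c(2)[OF that(3)] norm_Pair_le[of x y0] that by auto
    moreover have "norm ((x, \<xi>) - (x, y0)) \<le> \<rho>"
      using that(4) by (simp add: norm_Pair)
    ultimately show ?thesis
      using \<rho> norm_triangle_ineq2[of "(x, y0)" "(x, \<xi>)"] norm_triangle_ineq2[of "(x, \<xi>)" "(x, y0)"]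
      by (simp add: norm_minus_commute)
  qed
  have seg: "norm (\<xi> - y0) \<le> u" if "\<xi> \<in> closed_segment y' y" "norm (y - y0) \<le> u" "norm (y' - y0) \<le> u" for \<xi> y y' y0 :: "real^'n" and u
  proof -
    have "closed_segment y' y \<subseteq> cball y0 u"
      using that by (intro closed_segment_subset) (auto simp: dist_norm norm_minus_commute)
    with that show ?thesis
      by (auto simp: dist_norm norm_minus_commute)
  qed
  have mvt: "\<exists>\<xi>. norm (\<xi> - y0) \<le> u \<and> f (x, y) - f (x, y') = grad_y f (x, \<xi>) \<bullet> (y - y')"
    if x: "norm x \<le> 1" "norm y0 \<le> 1" "\<phi> (x, y0) \<ge> s" and u: "norm (y - y0) \<le> u" "norm (y' - y0) \<le> u" "u \<le> \<rho>"
      and f: "\<And>p. p \<noteq> 0 \<Longrightarrow> f differentiable (at p)" for x y0 y y' u and f :: "_ \<Rightarrow> real"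
  proof -
    have "((\<lambda>y. f (x, y)) has_derivative (\<lambda>h. grad_y f (x, \<xi>) \<bullet> h)) (at \<xi>)" if "\<xi> \<in> closed_segment y' y" for \<xi>
      using nz[OF inN[OF x order_trans[OF seg[OF that u(1,2)] u(3)]]] by (intro has_derivative_slice_y f)
    then obtain \<xi> where "\<xi> \<in> closed_segment y' y" "f (x, y) - f (x, y') = grad_y f (x, \<xi>) \<bullet> (y - y')"
      using mvt_closed_segment[of y' y "\<lambda>y. f (x, y)" "\<lambda>\<xi> h. grad_y f (x, \<xi>) \<bullet> h"] by blast
    with seg u show ?thesis
      by blast
  qed
  have lip: "norm (grad_y \<phi> (x, \<xi>) - grad_y \<phi> (x, y0)) \<le> M * u"
    if x: "norm x \<le> 1" "norm y0 \<le> 1" "\<phi> (x, y0) \<ge> s" and u: "norm (\<xi> - y0) \<le> u" "u \<le> \<rho>" for x y0 \<xi> u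
  proof -
    have u0: "u \<ge> 0"
      using u(1) norm_ge_zero order_trans by blast
    have "norm (grad_y \<phi> (x, \<xi>) - grad_y \<phi> (x, y0)) \<le> (\<Sum>j\<in>UNIV. \<bar>dy j \<phi> (x, \<xi>) - dy j \<phi> (x, y0)\<bar>)"
      using norm_le_l1_cart[of "grad_y \<phi> (x, \<xi>) - grad_y \<phi> (x, y0)"] by (simp add: grad_y_def)
    also have "\<dots> \<le> (\<Sum>j\<in>UNIV. (\<Sum>i\<in>UNIV. \<bar>B2 (i, j)\<bar>) * u)"
    proof (rule sum_mono)
      fix j
      obtain \<zeta> where \<zeta>: "norm (\<zeta> - y0) \<le> u" "dy j \<phi> (x, \<xi>) - dy j \<phi> (x, y0) = grad_y (dy j \<phi>) (x, \<zeta>) \<bullet> (\<xi> - y0)"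
        using mvt[OF x, of \<xi> u y0 "dy j \<phi>"] u u0 differentiable_dy by auto
      have \<zeta>N: "(x, \<zeta>) \<in> ?N"
        by (rule inN[OF x order_trans[OF \<zeta>(1) u(2)]])
      have "\<bar>dy j \<phi> (x, \<xi>) - dy j \<phi> (x, y0)\<bar> \<le> norm (grad_y (dy j \<phi>) (x, \<zeta>)) * norm (\<xi> - y0)"
        unfolding \<zeta>(2) by (rule Cauchy_Schwarz_ineq2)
      also have "\<dots> \<le> (\<Sum>i\<in>UNIV. \<bar>B2 (i, j)\<bar>) * u"
      proof (intro mult_mono u(1))
        have "norm (grad_y (dy j \<phi>) (x, \<zeta>)) \<le> (\<Sum>i\<in>UNIV. \<bar>dy i (dy j \<phi>) (x, \<zeta>)\<bar>)"
          using norm_le_l1_cart[of "grad_y (dy j \<phi>) (x, \<zeta>)"] by (simp add: grad_y_def)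
        also have "\<dots> \<le> (\<Sum>i\<in>UNIV. \<bar>B2 (i, j)\<bar>)"
          by (intro sum_mono order_trans[OF B2[OF \<zeta>N] abs_ge_self])
        finally show "norm (grad_y (dy j \<phi>) (x, \<zeta>)) \<le> (\<Sum>i\<in>UNIV. \<bar>B2 (i, j)\<bar>)" .
      qed (auto intro: sum_nonneg)
      finally show "\<bar>dy j \<phi> (x, \<xi>) - dy j \<phi> (x, y0)\<bar> \<le> (\<Sum>i\<in>UNIV. \<bar>B2 (i, j)\<bar>) * u" .
    qed
    also have "\<dots> \<le> M * u"
      using u0 pos(1) by (auto simp: sum_distrib_right[symmetric] M_def intro!: mult_right_mono)
    finally show ?thesis .
  qed
  show thesis
  proof (rule that[of M \<rho>])
    show "M \<ge> 1"
      using pos by (simp add: M_def)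
    show "\<rho> > 0"
      by (rule \<rho>(1))
    show "norm (grad_y \<phi> (x, y)) \<le> M" if "norm x \<le> 1" "norm y \<le> 1" "\<phi> (x, y) \<ge> s" for x y
      using grad_le[OF inN[OF that]] \<rho>(1) by simp
    show "\<bar>\<phi> (x, y) - \<phi> (x, y0)\<bar> \<le> M * norm (y - y0)"
      if x: "norm x \<le> 1" "norm y0 \<le> 1" "\<phi> (x, y0) \<ge> s" and y: "norm (y - y0) \<le> \<rho>" for x y0 y
    proof -
      obtain \<xi> where \<xi>: "norm (\<xi> - y0) \<le> \<rho>" "\<phi> (x, y) - \<phi> (x, y0) = grad_y \<phi> (x, \<xi>) \<bullet> (y - y0)"
        using mvt[OF x, of y \<rho> y0 \<phi>] y \<rho>(1) differentiable by auto
      show ?thesis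
        unfolding \<xi>(2) using grad_le[OF inN[OF x \<xi>(1)]]
        by (intro order_trans[OF Cauchy_Schwarz_ineq2] mult_right_mono) auto
    qed
    show "\<bar>\<phi> (x, y) - \<phi> (x, y') - (y - y') \<bullet> grad_y \<phi> (x, y0)\<bar> \<le> M * (norm (y - y') * u)"
      if x: "norm x \<le> 1" "norm y0 \<le> 1" "\<phi> (x, y0) \<ge> s"
        and u: "norm (y - y0) \<le> u" "norm (y' - y0) \<le> u" "u \<le> \<rho>"
      for x y0 y y' u
    proof -
      obtain \<xi> where \<xi>: "norm (\<xi> - y0) \<le> u" "\<phi> (x, y) - \<phi> (x, y') = grad_y \<phi> (x, \<xi>) \<bullet> (y - y')"
        using mvt[OF x u, of \<phi>] differentiable by auto
      have "\<phi> (x, y) - \<phi> (x, y') - (y - y') \<bullet> grad_y \<phi> (x, y0) = (grad_y \<phi> (x, \<xi>) - grad_y \<phi> (x, y0)) \<bullet> (y - y')"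
        unfolding \<xi>(2) by (metis inner_commute inner_diff_left)
      also have "\<bar>\<dots>\<bar> \<le> (M * u) * norm (y - y')"
        using lip[OF x \<xi>(1) u(3)]
        by (intro order_trans[OF Cauchy_Schwarz_ineq2] mult_right_mono) auto
      finally show ?thesis
        by (simp add: mult_ac)
    qed
  qed
qed

end

section \<open>Pairs with values in a short interval\<close>

context rotational_curvature
begin

text \<open>The radius is Q = r^(d+1) and the interval length r^(1-d). With \<open>r\<close> as
  parameter, all scales up to the final theorem are powers with integer exponents.\<close>

definition pairs :: "real \<Rightarrow> real \<Rightarrow> ((real^'n) \<times> (real^'n)) set" where
  "pairs r t = {(n, m). n \<in> int_points \<and> m \<in> int_points \<and> norm n \<le> r ^ (CARD('n) + 1) \<and>
     norm m \<le> r ^ (CARD('n) + 1) \<and> t \<le> \<phi> (n, m) \<and> \<phi> (n, m) \<le> t + 1 / r ^ (CARD('n) - 1)}"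

lemma finite_int_points_cball: "finite {n \<in> (int_points :: (real^'n) set). norm n \<le> R}"
  by (rule finite_int_points_cube[of _ R]) (auto intro: order_trans[OF component_le_norm_cart])

lemma finite_pairs: "finite (pairs r t)"
proof (rule finite_subset)
  show "pairs r t \<subseteq> {n \<in> int_points. norm n \<le> r ^ (CARD('n) + 1)} \<times> {m \<in> int_points. norm m \<le> r ^ (CARD('n) + 1)}"
    by (auto simp: pairs_def)
qed (intro finite_cartesian_product finite_int_points_cball)

text \<open>
  Writing \<open>Q = r^(d+1)\<close> and \<open>\<delta> = r^(1-d)\<close>, so that \<open>Q \<delta> = r\<^sup>2\<close>, the radius \<open>r\<close> is the largest scale at
  which the level surfaces of \<open>\<phi>\<close> in the ball of radius \<open>Q\<close> are flat up to \<open>O(\<delta>)\<close>.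
\<close>

lemma pairs_cell_card_le:
  obtains K r0 where "K > 0" "r0 \<ge> 1"
    "\<And>r t T. \<lbrakk>r \<ge> r0; t \<ge> \<tau> * r ^ (CARD('n) + 1); T \<subseteq> pairs r t;
      \<forall>p\<in>T. \<forall>p'\<in>T. \<forall>k. \<bar>snd p $ k - snd p' $ k\<bar> \<le> r\<rbrakk> \<Longrightarrow>
      real (card T) \<le> K * ((r ^ (CARD('n) + 1)) ^ (CARD('n) - 1) * r)"
proof -
  define d where "d = real CARD('n)"
  have d: "d \<ge> 2"
    using dim by (simp add: d_def)
  \<comment> \<open>Half of \<open>\<tau>\<close> is given away when the second variable is moved to
    the common base point \<open>y0\<close>.\<close>
  have \<tau>2: "\<tau> / 2 > 0"
    using tau_pos by simp
  obtain K where K: "K > 0" "\<And>Q y w t a \<eta>. \<lbrakk>Q \<ge> 1; a \<ge> 1; \<eta> > 0; Q * \<eta> \<ge> 1; norm y \<le> 1; norm w = 1\<rbrakk> \<Longrightarrow>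
      real (card {n \<in> slab Q y w t a \<eta>. \<phi> (n /\<^sub>R Q, y) \<ge> \<tau> / 2}) \<le> K * (Q ^ (CARD('n) - 1) * a * \<eta>)"
    by (rule slab_card_le[OF \<tau>2]) (rule that; assumption)
  obtain M \<rho> where M: "M \<ge> 1" and \<rho>: "\<rho> > 0"
    and grad: "\<And>x y. \<lbrakk>norm x \<le> 1; norm y \<le> 1; \<phi> (x, y) \<ge> \<tau> / 2\<rbrakk> \<Longrightarrow> norm (grad_y \<phi> (x, y)) \<le> M"
    and lip: "\<And>x y0 y. \<lbrakk>norm x \<le> 1; norm y0 \<le> 1; \<phi> (x, y0) \<ge> \<tau> / 2; norm (y - y0) \<le> \<rho>\<rbrakk> \<Longrightarrow>
      \<bar>\<phi> (x, y) - \<phi> (x, y0)\<bar> \<le> M * norm (y - y0)"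
    and tay: "\<And>x y0 y y' u. \<lbrakk>norm x \<le> 1; norm y0 \<le> 1; \<phi> (x, y0) \<ge> \<tau> / 2; norm (y - y0) \<le> u; norm (y' - y0) \<le> u; u \<le> \<rho>\<rbrakk> \<Longrightarrow>
      \<bar>\<phi> (x, y) - \<phi> (x, y') - (y - y') \<bullet> grad_y \<phi> (x, y0)\<bar> \<le> M * (norm (y - y') * u)"
    by (rule taylor_in_y[OF \<tau>2]) (rule that; assumption)
  define L where "L = 2 * 3 ^ (CARD('n) - 1) * d"
  \<comment> \<open>The 1 comes from the length of the interval and \<open>M * d\<^sup>2\<close>
    from the Taylor error, which is of the same order because
    \<open>Q * \<delta> = r\<^sup>2\<close>. That \<open>C2 \<ge> d\<close> later ensures
    \<open>Q * \<eta> \<ge> 1\<close>.\<close>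
  define C2 where "C2 = 1 + M * d\<^sup>2"
  have "d * d \<le> M * (d * d)"
    using M d mult_right_mono[of 1 M "d * d"] by simp
  moreover have "d * 1 \<le> d * d"
    using d by (intro mult_left_mono) auto
  ultimately have C2: "C2 \<ge> d" "C2 > 0"
    using d unfolding C2_def power2_eq_square by linarith+
  have L: "L > 0"
    using d by (simp add: L_def)
  \<comment> \<open>Large enough for the rescaled cube size \<open>u \<le> d / r\<close> to satisfy
    \<open>u \<le> \<rho>\<close> and \<open>M * u \<le> \<tau> / 2\<close>.\<close>
  define r0 where "r0 = 1 + d / \<rho> + 2 * d * M / \<tau>"
  have "d / \<rho> \<ge> 0" "2 * d * M / \<tau> \<ge> 0"
    using d \<rho> M tau_pos by auto
  then have r0: "r0 \<ge> 1" "r0 \<ge> d / \<rho>" "r0 \<ge> 2 * d * M / \<tau>"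
    by (auto simp: r0_def)
  show thesis
  proof (rule that[of "K * (M * d + 1) * (M + C2 * L)" r0])
    show "K * (M * d + 1) * (M + C2 * L) > 0"
      using K(1) M d C2 L by (intro mult_pos_pos add_pos_pos) auto
    show "r0 \<ge> 1"
      by (rule r0(1))
    fix r t and T :: "((real^'n) \<times> (real^'n)) set"
    assume rr0: "r \<ge> r0" and t: "t \<ge> \<tau> * r ^ (CARD('n) + 1)" and T: "T \<subseteq> pairs r t"
      and "\<forall>p\<in>T. \<forall>p'\<in>T. \<forall>k. \<bar>snd p $ k - snd p' $ k\<bar> \<le> r"
    then have close: "\<bar>m $ k - m' $ k\<bar> \<le> r" if "(n, m) \<in> T" "(n', m') \<in> T" for n m n' m' k
      using that by (metis snd_conv)
    define Q where "Q = r ^ (CARD('n) + 1)"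
    define \<delta> where "\<delta> = 1 / r ^ (CARD('n) - 1)"
    \<comment> \<open>\<open>u\<close> bounds the rescaled diameter of a cube of side
      \<open>r\<close>, through the sum of the coordinates. Accordingly \<open>a\<close> allows for
      the change \<open>M * d * r\<close> of \<open>\<phi>\<close> over the cube and for the
      interval length \<open>\<delta> \<le> r\<close>.\<close>
    define u where "u = d * r / Q"
    define a where "a = (M * d + 1) * r"
    have r: "r \<ge> 1"
      using rr0 r0 by simp
    have Q: "Q \<ge> 1"
      using r unfolding Q_def by (rule one_le_power)
    have \<delta>: "\<delta> > 0" "\<delta> \<le> 1" "\<delta> * r ^ (CARD('n) - 1) = 1"
      using r one_le_power[OF r, of "CARD('n) - 1"] by (simp_all add: \<delta>_def)
    have "CARD('n) + 1 = (CARD('n) - 1) + 2"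
      using dim by simp
    then have "Q = r ^ (CARD('n) - 1) * r\<^sup>2"
      unfolding Q_def power_add[symmetric] by simp
    then have Q\<delta>: "Q * \<delta> = r\<^sup>2"
      using \<delta>(3) by (simp add: mult_ac)
    have "r\<^sup>2 \<le> Q"
      using r dim unfolding Q_def by (intro power_increasing) auto
    then have "u \<le> d / r"
      using r Q d by (auto simp: u_def divide_simps power2_eq_square)
    moreover have "d / \<rho> \<le> r" "2 * d * M / \<tau> \<le> r"
      using rr0 r0 by linarith+
    then have "d / r \<le> \<rho>" "M * (d / r) \<le> \<tau> / 2"
      using r \<rho> tau_pos by (simp_all add: divide_simps mult_ac)
    moreover have "u \<ge> 0"
      using d Q r by (simp add: u_def)
    ultimately have u: "u \<le> \<rho>" "M * u \<le> \<tau> / 2" "u \<ge> 0"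
      using M mult_left_mono[of u "d / r" M] by linarith+
    have a: "a \<ge> 1" "M * u + \<delta> / Q \<le> a / Q"
    proof -
      have "M * d \<ge> 0"
        using M d by simp
      then show "a \<ge> 1"
        unfolding a_def using r mult_mono[of 1 "M * d + 1" 1 r] by simp
      have "M * u + \<delta> / Q = (M * d * r + \<delta>) / Q"
        by (simp add: u_def add_divide_distrib)
      also have "\<dots> \<le> a / Q"
        using \<delta>(2) r Q by (intro divide_right_mono) (auto simp: a_def algebra_simps)
      finally show "M * u + \<delta> / Q \<le> a / Q" .
    qed
    show "real (card T) \<le> K * (M * d + 1) * (M + C2 * L) * ((r ^ (CARD('n) + 1)) ^ (CARD('n) - 1) * r)"
    proof (cases "T = {}")
      case True
      have "K * (M * d + 1) * (M + C2 * L) * ((r ^ (CARD('n) + 1)) ^ (CARD('n) - 1) * r) \<ge> 0"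
        using K(1) M d C2 L r by (intro mult_nonneg_nonneg add_nonneg_nonneg) auto
      with True show ?thesis
        by simp
    next
      case False
      then obtain n0 m0 where m0: "(n0, m0) \<in> T"
        by auto
      define y0 where "y0 = m0 /\<^sub>R Q"
      \<comment> \<open>For each \<open>n\<close> one admissible partner \<open>\<mu> n\<close> is
        fixed, and \<open>m\<close> is replaced by \<open>m - \<mu> n\<close>. The pair of this
        difference and \<open>n\<close> still determines \<open>(n, m)\<close>, while the constraint
        on the difference involves only \<open>n\<close> and \<open>y0\<close>.\<close>
      define \<mu> where "\<mu> n = (SOME m. (n, m) \<in> T)" for n
      have \<mu>: "(n, \<mu> n) \<in> T" if "(n, m) \<in> T" for n m
        using someI[of "\<lambda>m. (n, m) \<in> T", OF that] by (simp add: \<mu>_def)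
      have inT: "n \<in> int_points" "m \<in> int_points" "norm (n /\<^sub>R Q) \<le> 1" "norm (m /\<^sub>R Q) \<le> 1" "norm n \<le> Q"
        "t / Q \<le> \<phi> (n /\<^sub>R Q, m /\<^sub>R Q)" "\<phi> (n /\<^sub>R Q, m /\<^sub>R Q) \<le> (t + \<delta>) / Q" if "(n, m) \<in> T" for n m
      proof -
        have "(n, m) \<in> pairs r t"
          using T that by blast
        then have *: "n \<in> int_points \<and> m \<in> int_points \<and> norm n \<le> Q \<and> norm m \<le> Q \<and>
            t \<le> \<phi> (n, m) \<and> \<phi> (n, m) \<le> t + \<delta>"
          unfolding pairs_def Q_def \<delta>_def by simp
        have "\<phi> (n /\<^sub>R Q, m /\<^sub>R Q) = \<phi> (n, m) / Q"
          using homogeneous[of "inverse Q" "(n, m)"] Q by (simp add: divide_inverse mult.commute)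
        with * Q show "n \<in> int_points" "m \<in> int_points" "norm (n /\<^sub>R Q) \<le> 1" "norm (m /\<^sub>R Q) \<le> 1" "norm n \<le> Q"
          "t / Q \<le> \<phi> (n /\<^sub>R Q, m /\<^sub>R Q)" "\<phi> (n /\<^sub>R Q, m /\<^sub>R Q) \<le> (t + \<delta>) / Q"
          by (simp_all add: divide_right_mono) (simp_all add: divide_simps)
      qed
      have y0: "norm y0 \<le> 1"
        using inT(4)[OF m0] by (simp add: y0_def)
      have norm_diff: "norm (m /\<^sub>R Q - m' /\<^sub>R Q) \<le> u" if "(n, m) \<in> T" "(n', m') \<in> T" for n m n' m'
      proof -
        have "norm (m - m') \<le> (\<Sum>k\<in>UNIV. \<bar>(m - m') $ k\<bar>)"
          by (rule norm_le_l1_cart)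
        also have "\<dots> \<le> real (card (UNIV :: 'n set)) * r"
          using close[OF that] by (intro sum_bounded_above) simp
        finally have "norm (m - m') / Q \<le> u"
          using Q by (auto simp: u_def d_def intro: divide_right_mono)
        moreover have "m /\<^sub>R Q - m' /\<^sub>R Q = (m - m') /\<^sub>R Q"
          by (simp add: scaleR_diff_right)
        ultimately show ?thesis
          using Q by (simp add: divide_inverse_commute)
      qed
      have base: "\<phi> (n /\<^sub>R Q, y0) \<ge> \<tau> / 2" "\<bar>\<phi> (n /\<^sub>R Q, y0) - t / Q\<bar> \<le> a / Q" if nm: "(n, m) \<in> T" for n m
      proof -
        have "\<tau> \<le> t / Q"
          using t[folded Q_def] Q by (simp add: le_divide_eq)
        then have "\<tau> \<le> \<phi> (n /\<^sub>R Q, m /\<^sub>R Q)"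
          using inT(6)[OF nm] by linarith
        moreover have dist: "norm (y0 - m /\<^sub>R Q) \<le> u"
          unfolding y0_def by (rule norm_diff[OF m0 nm])
        ultimately have "\<bar>\<phi> (n /\<^sub>R Q, y0) - \<phi> (n /\<^sub>R Q, m /\<^sub>R Q)\<bar> \<le> M * norm (y0 - m /\<^sub>R Q)"
          using lip inT[OF nm] u(1) tau_pos by auto
        also have "\<dots> \<le> M * u"
          using dist M by (intro mult_left_mono) auto
        finally have *: "\<bar>\<phi> (n /\<^sub>R Q, y0) - \<phi> (n /\<^sub>R Q, m /\<^sub>R Q)\<bar> \<le> M * u" .
        then show "\<phi> (n /\<^sub>R Q, y0) \<ge> \<tau> / 2"
          using u(2) \<open>\<tau> \<le> \<phi> (n /\<^sub>R Q, m /\<^sub>R Q)\<close> by linarith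
        show "\<bar>\<phi> (n /\<^sub>R Q, y0) - t / Q\<bar> \<le> a / Q"
          using * a(2) inT(6,7)[OF nm] unfolding add_divide_distrib by linarith
      qed
      have direction: "\<bar>(m - m') \<bullet> grad_y \<phi> (n /\<^sub>R Q, y0)\<bar> \<le> C2 * \<delta>" if nm: "(n, m) \<in> T" "(n, m') \<in> T" for n m m'
      proof -
        let ?g = "grad_y \<phi> (n /\<^sub>R Q, y0)"
        have "\<bar>\<phi> (n /\<^sub>R Q, m /\<^sub>R Q) - \<phi> (n /\<^sub>R Q, m' /\<^sub>R Q) - (m /\<^sub>R Q - m' /\<^sub>R Q) \<bullet> ?g\<bar>
            \<le> M * (norm (m /\<^sub>R Q - m' /\<^sub>R Q) * u)"
          using norm_diff[OF nm(1) m0] norm_diff[OF nm(2) m0] u(1)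
          by (intro tay inT(3)[OF nm(1)] y0 base(1)[OF nm(1)]) (simp_all add: y0_def)
        also have "\<dots> \<le> M * (u * u)"
          using norm_diff[OF nm] u(3) M by (intro mult_left_mono mult_right_mono) auto
        finally have "\<bar>(m /\<^sub>R Q - m' /\<^sub>R Q) \<bullet> ?g\<bar> \<le> \<delta> / Q + M * (u * u)"
          using inT(6,7)[OF nm(1)] inT(6,7)[OF nm(2)] unfolding add_divide_distrib by linarith
        moreover have "(m /\<^sub>R Q - m' /\<^sub>R Q) \<bullet> ?g = ((m - m') \<bullet> ?g) / Q"
          by (simp add: scaleR_diff_right[symmetric] divide_inverse_commute)
        ultimately have "\<bar>(m - m') \<bullet> ?g\<bar> / Q \<le> \<delta> / Q + M * (u * u)"
          using Q by simp
        also have "M * (u * u) = M * d\<^sup>2 * (Q * \<delta>) / Q / Q"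
          unfolding Q\<delta> by (simp add: u_def power2_eq_square)
        also have "\<dots> = M * d\<^sup>2 * \<delta> / Q"
          using Q by simp
        finally show ?thesis
          using Q by (simp add: C2_def divide_simps distrib_right)
      qed
      define H where "H = {h::real^'n. h \<in> int_points \<and> (\<forall>k. \<bar>h $ k\<bar> \<le> r)}"
      define X where "X h = {n \<in> int_points. norm n \<le> Q \<and> \<bar>\<phi> (n /\<^sub>R Q, y0) - t / Q\<bar> \<le> a / Q \<and>
        \<phi> (n /\<^sub>R Q, y0) \<ge> \<tau> / 2 \<and> \<bar>h \<bullet> grad_y \<phi> (n /\<^sub>R Q, y0)\<bar> \<le> C2 * \<delta>}" for h
      have finH: "finite H"
        by (rule finite_int_points_cube[of _ r]) (auto simp: H_def)
      have finX: "finite (X h)" for h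
        by (rule finite_subset[OF _ finite_int_points_cball[of Q]]) (auto simp: X_def)
      have "inj_on (\<lambda>(n, m). (m - \<mu> n, n)) T"
        by (auto intro!: inj_onI)
      moreover have "(\<lambda>(n, m). (m - \<mu> n, n)) ` T \<subseteq> Sigma H X"
      proof (clarify, intro conjI)
        fix n m assume nm: "(n, m) \<in> T"
        have "m - \<mu> n \<in> int_points"
          using inT(2)[OF nm] inT(2)[OF \<mu>[OF nm]] by (auto simp: int_points_def)
        then show "m - \<mu> n \<in> H"
          using close[OF nm \<mu>[OF nm]] by (auto simp: H_def)
        show "n \<in> X (m - \<mu> n)"
          using inT[OF nm] base[OF nm] direction[OF nm \<mu>[OF nm]] by (auto simp: X_def)
      qed
      ultimately have "card T \<le> card (Sigma H X)"
        using finH finX by (intro card_inj_on_le) auto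
      also have "\<dots> = (\<Sum>h\<in>H. card (X h))"
        using finH finX by simp
      finally have "real (card T) \<le> (\<Sum>h\<in>H. real (card (X h)))"
        by (simp only: of_nat_sum[symmetric] of_nat_le_iff)
      also have "\<dots> = real (card (X 0)) + (\<Sum>h\<in>H - {0}. real (card (X h)))"
        using r by (intro sum.remove finH) (auto simp: H_def int_points_def)
      also have "\<dots> \<le> K * (Q ^ (CARD('n) - 1) * a * M) + (\<Sum>h\<in>H - {0}. K * (Q ^ (CARD('n) - 1) * a * (C2 * \<delta> / norm h)))"
      proof (intro add_mono sum_mono)
        \<comment> \<open>For \<open>h = 0\<close> there is no directional constraint. Any unit
          vector serves, with width \<open>M\<close>, since the gradient has norm at most
          \<open>M\<close>.\<close>
        let ?w = "axis undefined 1 :: real^'n"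
        have "X 0 \<subseteq> {n \<in> slab Q y0 ?w (t / Q) a M. \<phi> (n /\<^sub>R Q, y0) \<ge> \<tau> / 2}"
        proof
          fix n assume n: "n \<in> X 0"
          have "norm (n /\<^sub>R Q) \<le> 1"
            using n Q by (simp add: X_def divide_simps)
          then have "norm (grad_y \<phi> (n /\<^sub>R Q, y0)) \<le> M"
            using n y0 by (intro grad) (auto simp: X_def)
          then have "\<bar>?w \<bullet> grad_y \<phi> (n /\<^sub>R Q, y0)\<bar> \<le> M"
            using Cauchy_Schwarz_ineq2[of ?w "grad_y \<phi> (n /\<^sub>R Q, y0)"] by simp
          with n show "n \<in> {n \<in> slab Q y0 ?w (t / Q) a M. \<phi> (n /\<^sub>R Q, y0) \<ge> \<tau> / 2}"
            by (simp add: X_def slab_def)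
        qed
        then have "card (X 0) \<le> card {n \<in> slab Q y0 ?w (t / Q) a M. \<phi> (n /\<^sub>R Q, y0) \<ge> \<tau> / 2}"
          using finite_slab by (intro card_mono) auto
        then show "real (card (X 0)) \<le> K * (Q ^ (CARD('n) - 1) * a * M)"
          using K(2)[of Q a M y0 ?w "t / Q"] Q a(1) M y0 mult_mono[of 1 Q 1 M] by simp
      next
        fix h assume h: "h \<in> H - {0}"
        \<comment> \<open>Passing to the unit direction \<open>sgn h\<close> divides the width by
          \<open>norm h\<close>. The slab bound requires \<open>Q * ?\<eta> \<ge> 1\<close>, that is
          \<open>norm h \<le> C2 * r\<^sup>2\<close>, which the cube of differences
          guarantees.\<close>
        let ?\<eta> = "C2 * \<delta> / norm h"
        have "norm h \<le> (\<Sum>k\<in>UNIV. \<bar>h $ k\<bar>)"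
          by (rule norm_le_l1_cart)
        also have "\<dots> \<le> real (card (UNIV :: 'n set)) * r"
          using h by (intro sum_bounded_above) (auto simp: H_def)
        also have "\<dots> \<le> C2 * r\<^sup>2"
          using C2 r d unfolding d_def[symmetric] power2_eq_square mult.assoc[symmetric]
          by (intro mult_right_mono) (auto intro: order_trans[OF C2(1)] simp: mult_le_cancel_left1)
        also have "\<dots> = Q * (C2 * \<delta>)"
          unfolding Q\<delta>[symmetric] by simp
        finally have Q\<eta>: "Q * ?\<eta> \<ge> 1"
          using h by (simp add: le_divide_eq)
        have "X h \<subseteq> {n \<in> slab Q y0 (sgn h) (t / Q) a ?\<eta>. \<phi> (n /\<^sub>R Q, y0) \<ge> \<tau> / 2}"
        proof
          fix n assume n: "n \<in> X h"
          have "\<bar>sgn h \<bullet> grad_y \<phi> (n /\<^sub>R Q, y0)\<bar> = \<bar>h \<bullet> grad_y \<phi> (n /\<^sub>R Q, y0)\<bar> / norm h"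
            by (simp add: sgn_div_norm abs_mult divide_inverse_commute)
          also have "\<dots> \<le> ?\<eta>"
            using n by (intro divide_right_mono) (auto simp: X_def)
          finally show "n \<in> {n \<in> slab Q y0 (sgn h) (t / Q) a ?\<eta>. \<phi> (n /\<^sub>R Q, y0) \<ge> \<tau> / 2}"
            using n by (simp add: X_def slab_def)
        qed
        then have "card (X h) \<le> card {n \<in> slab Q y0 (sgn h) (t / Q) a ?\<eta>. \<phi> (n /\<^sub>R Q, y0) \<ge> \<tau> / 2}"
          using finite_slab by (intro card_mono) auto
        moreover have "?\<eta> > 0" "norm (sgn h) = 1"
          using h C2 \<delta> by (auto simp: norm_sgn)
        ultimately show "real (card (X h)) \<le> K * (Q ^ (CARD('n) - 1) * a * ?\<eta>)"
          using K(2)[of Q a ?\<eta> y0 "sgn h" "t / Q"] Q a(1) y0 Q\<eta> by linarith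
      qed
      also have "\<dots> = K * Q ^ (CARD('n) - 1) * a * (M + C2 * \<delta> * (\<Sum>h\<in>H - {0}. 1 / norm h))"
        by (simp add: sum_distrib_left algebra_simps)
      also have "\<dots> \<le> K * Q ^ (CARD('n) - 1) * a * (M + C2 * \<delta> * (L * r ^ (CARD('n) - 1)))"
        using sum_inverse_norm_int_points_le[OF r dim] K(1) Q a(1) C2(2) \<delta>(1)
        unfolding H_def L_def d_def by (intro mult_left_mono add_left_mono) auto
      also have "\<dots> = K * Q ^ (CARD('n) - 1) * a * (M + C2 * L * (\<delta> * r ^ (CARD('n) - 1)))"
        by (simp add: mult_ac)
      also have "\<dots> = K * (M * d + 1) * (M + C2 * L) * (Q ^ (CARD('n) - 1) * r)"
        unfolding \<delta>(3) by (simp add: a_def mult_ac)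
      finally show ?thesis
        unfolding Q_def .
    qed
  qed
qed

text \<open>The ball of the \<open>m\<close> is cut into O((Q/r)^d) cubes of side \<open>r\<close>,
  each contributing O(Q^(d-1) r). With Q = r^(d+1) the total exponent of \<open>r\<close> is 2 d^2.
  For \<open>r\<close> below the threshold \<open>r0\<close> the number of all integer pairs is
  bounded outright.\<close>

lemma pairs_card_le:
  obtains K where "K > 0"
    "\<And>r t. \<lbrakk>r \<ge> 1; t \<ge> \<tau> * r ^ (CARD('n) + 1)\<rbrakk> \<Longrightarrow> real (card (pairs r t)) \<le> K * r ^ (2 * CARD('n) * CARD('n))"
proof -
  obtain K r0 where K: "K > 0" "r0 \<ge> 1"
    "\<And>r t T. \<lbrakk>r \<ge> r0; t \<ge> \<tau> * r ^ (CARD('n) + 1); T \<subseteq> pairs r t;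
      \<forall>p\<in>T. \<forall>p'\<in>T. \<forall>k. \<bar>snd p $ k - snd p' $ k\<bar> \<le> r\<rbrakk> \<Longrightarrow>
      real (card T) \<le> K * ((r ^ (CARD('n) + 1)) ^ (CARD('n) - 1) * r)"
    by (rule pairs_cell_card_le) (rule that; assumption)
  define K0 where "K0 = (2 * r0 ^ (CARD('n) + 1) + 1) ^ CARD('n) * (2 * r0 ^ (CARD('n) + 1) + 1) ^ CARD('n)"
  have K0: "K0 > 0"
    using K(2) by (simp add: K0_def add_pos_nonneg)
  show thesis
  proof (rule that[of "K0 + 5 ^ CARD('n) * K"])
    show "K0 + 5 ^ CARD('n) * K > 0"
      using K0 K(1) by (intro add_pos_pos mult_pos_pos) auto
    fix r t :: real
    assume r: "r \<ge> 1" and t: "t \<ge> \<tau> * r ^ (CARD('n) + 1)"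
    let ?Q = "r ^ (CARD('n) + 1)" and ?P = "r ^ (2 * CARD('n) * CARD('n))"
    let ?N = "{n \<in> (int_points :: (real^'n) set). norm n \<le> ?Q}"
    have P1: "?P \<ge> 1" and Q1: "?Q \<ge> 1"
      by (rule one_le_power[OF r])+
    have sub: "pairs r t \<subseteq> ?N \<times> ?N"
      by (auto simp: pairs_def)
    show "real (card (pairs r t)) \<le> (K0 + 5 ^ CARD('n) * K) * ?P"
    proof (cases "r \<ge> r0")
      case False
      have "real (card ?N) \<le> (2 * ?Q + 1) ^ CARD('n)"
      proof (rule card_int_points_cube_le)
        show "\<bar>m $ k\<bar> \<le> ?Q" if "m \<in> ?N" for m k
          using order_trans[OF component_le_norm_cart] that by blast
      qed (use Q1 in auto)
      also have "\<dots> \<le> (2 * r0 ^ (CARD('n) + 1) + 1) ^ CARD('n)"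
        using False r by (intro power_mono add_right_mono mult_left_mono) auto
      finally have N: "real (card ?N) \<le> (2 * r0 ^ (CARD('n) + 1) + 1) ^ CARD('n)" .
      have "real (card (pairs r t)) \<le> real (card (?N \<times> ?N))"
        unfolding of_nat_le_iff
        by (intro card_mono sub finite_cartesian_product finite_int_points_cball)
      also have "\<dots> = real (card ?N) * real (card ?N)"
        by (simp add: card_cartesian_product)
      also have "\<dots> \<le> K0"
        unfolding K0_def using K(2) by (intro mult_mono N) auto
      also have "\<dots> \<le> (K0 + 5 ^ CARD('n) * K) * ?P"
        using K0 K(1) P1 mult_mono[of K0 "K0 + 5 ^ CARD('n) * K" 1 ?P] by simp
      finally show ?thesis .
    next
      case True
      let ?g = "\<lambda>(m::real^'n) k. \<lfloor>m $ k / r\<rfloor>"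
      \<comment> \<open>The floor of a negative number can increase its modulus by up to 1, hence
        the summand 1. As \<open>?Q / r \<ge> 1\<close>, the count \<open>2 * ?R + 1\<close> is at
        most five times \<open>?Q / r\<close>.\<close>
      let ?R = "?Q / r + 1"
      let ?Cells = "PiE (UNIV::'n set) (\<lambda>_. {- \<lfloor>?R\<rfloor>..\<lfloor>?R\<rfloor>})"
      let ?T = "\<lambda>c. {(n, m) \<in> pairs r t. ?g m = c}"
      have Qr: "?Q / r = r ^ CARD('n)"
        using r by simp
      have Qr1: "?Q / r \<ge> 1"
        unfolding Qr by (rule one_le_power[OF r])
      have finC: "finite ?Cells"
        by (intro finite_PiE) auto
      have "pairs r t \<subseteq> (\<Union>c\<in>?Cells. ?T c)"
      proof (clarify)
        fix n m assume nm: "(n, m) \<in> pairs r t"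
        have "\<lfloor>m $ k / r\<rfloor> \<in> {- \<lfloor>?R\<rfloor>..\<lfloor>?R\<rfloor>}" for k
        proof -
          have "\<bar>m $ k\<bar> \<le> ?Q"
            using nm component_le_norm_cart[of m k] by (auto simp: pairs_def)
          then have "\<bar>m $ k\<bar> / r \<le> ?Q / r"
            using r by (intro divide_right_mono) auto
          then have "\<bar>m $ k / r\<bar> \<le> ?Q / r"
            using r by (simp add: abs_divide)
          then have "\<bar>real_of_int \<lfloor>m $ k / r\<rfloor>\<bar> \<le> ?R"
            by linarith
          from floor_in_integer_interval[OF this] show ?thesis
            by simp
        qed
        then show "(n, m) \<in> (\<Union>c\<in>?Cells. ?T c)"
          using nm by auto
      qed
      then have "card (pairs r t) \<le> card (\<Union>c\<in>?Cells. ?T c)"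
        using finC by (intro card_mono finite_UN_I) (auto intro: finite_subset[OF _ finite_pairs[of r t]])
      also have "\<dots> \<le> (\<Sum>c\<in>?Cells. card (?T c))"
        by (rule card_UN_le[OF finC])
      finally have "real (card (pairs r t)) \<le> (\<Sum>c\<in>?Cells. real (card (?T c)))"
        by (simp only: of_nat_sum[symmetric] of_nat_le_iff)
      also have "\<dots> \<le> real (card ?Cells) * (K * (?Q ^ (CARD('n) - 1) * r))"
      proof (rule sum_bounded_above)
        fix c
        show "real (card (?T c)) \<le> K * (?Q ^ (CARD('n) - 1) * r)"
        proof (rule K(3)[OF True t])
          show "\<forall>p\<in>?T c. \<forall>p'\<in>?T c. \<forall>k. \<bar>snd p $ k - snd p' $ k\<bar> \<le> r"
          proof (intro ballI allI)
            fix p p' k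
            assume "p \<in> ?T c" "p' \<in> ?T c"
            then have "\<lfloor>snd p $ k / r\<rfloor> = \<lfloor>snd p' $ k / r\<rfloor>"
              by (auto dest: fun_cong[of _ _ k])
            then have "\<bar>snd p $ k / r - snd p' $ k / r\<bar> \<le> 1"
              by linarith
            then show "\<bar>snd p $ k - snd p' $ k\<bar> \<le> r"
              using r by (simp add: diff_divide_distrib[symmetric] abs_divide divide_le_eq)
          qed
        qed auto
      qed
      also have "\<dots> \<le> (5 * (?Q / r)) ^ CARD('n) * (K * (?Q ^ (CARD('n) - 1) * r))"
      proof (rule mult_right_mono)
        have "real (card ?Cells) = real (card {- \<lfloor>?R\<rfloor>..\<lfloor>?R\<rfloor>}) ^ CARD('n)"
          by (simp only: card_PiE finite prod_constant of_nat_power)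
        also have "\<dots> \<le> (2 * ?R + 1) ^ CARD('n)"
          using Qr1 by (intro power_mono card_integer_interval_le) auto
        also have "\<dots> \<le> (5 * (?Q / r)) ^ CARD('n)"
          using Qr1 by (intro power_mono) auto
        finally show "real (card ?Cells) \<le> (5 * (?Q / r)) ^ CARD('n)" .
      qed (use K(1) r in auto)
      also have "\<dots> = 5 ^ CARD('n) * K * (r ^ (CARD('n) * CARD('n)) * r ^ ((CARD('n) + 1) * (CARD('n) - 1)) * r ^ 1)"
        unfolding Qr power_mult_distrib power_mult[symmetric] by (simp only: mult_ac power_one_right)
      also have "\<dots> = 5 ^ CARD('n) * K * r ^ (CARD('n) * CARD('n) + (CARD('n) + 1) * (CARD('n) - 1) + 1)"
        by (simp only: power_add)
      also have "CARD('n) * CARD('n) + (CARD('n) + 1) * (CARD('n) - 1) + 1 = 2 * CARD('n) * CARD('n)"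
      proof -
        obtain e where "CARD('n) = Suc e"
          using dim not0_implies_Suc by force
        then show ?thesis
          by simp
      qed
      also have "5 ^ CARD('n) * K * ?P \<le> (K0 + 5 ^ CARD('n) * K) * ?P"
        using K0 P1 by (intro mult_right_mono) auto
      finally show ?thesis .
    qed
  qed
qed

end

section \<open>Intervals of arbitrary length and return to the parameter q\<close>

theorem theorem1p1:
  fixes \<phi> :: "(real^'n) \<times> (real^'n) \<Rightarrow> real" and C :: real
  assumes dim: "CARD('n) \<ge> 2"
    and homogeneous: "\<And>c x y. c > 0 \<Longrightarrow> \<phi> (c *\<^sub>R x, c *\<^sub>R y) = c * \<phi> (x, y)"
    and smooth: "C_class_on (CARD('n) div 2 + 1) \<phi> (- {0})"
    and gradients: "\<And>t. t > 0 \<Longrightarrow>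
      \<exists>U. open U \<and> {p \<in> cball 0 1 \<times> cball 0 1. \<phi> p = t} \<subseteq> U \<and>
        (\<forall>p\<in>U. grad_x \<phi> p \<noteq> 0 \<and> grad_y \<phi> p \<noteq> 0)"
    and monge_ampere: "\<And>t p. t > 0 \<Longrightarrow> p \<in> cball 0 1 \<times> cball 0 1 \<Longrightarrow> \<phi> p = t \<Longrightarrow>
      det (monge_ampere_matrix \<phi> p) \<noteq> 0"
    and C: "C > 0"
  shows "\<exists>K::real. \<forall>q::real. \<forall>\<delta>::real. q \<ge> 1 \<longrightarrow> \<delta> > 0 \<longrightarrow>
    q powr (- real CARD('n)) *
      real (card {(n, m). n \<in> (int_points :: (real^'n) set) \<and> m \<in> (int_points :: (real^'n) set) \<and>
        norm n \<le> C * q \<and> norm m \<le> C * q \<and> q \<le> \<phi> (n, m) \<and> \<phi> (n, m) \<le> q + \<delta>})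
    \<le> K * max (q powr (real CARD('n) - 2 + 2 / (real CARD('n) + 1)))
              (q powr (real CARD('n) - 1) * \<delta>)"
proof -
  define d where "d = real CARD('n)"
  \<comment> \<open>The radius C q is enlarged to \<open>\<Lambda> * q\<close>, which is at least 1
    and serves as \<open>Q\<close>. Levels from \<open>q\<close> on are then at least
    \<open>1 / \<Lambda>\<close> times the radius, which explains the value chosen for
    \<open>\<tau>\<close>.\<close>
  define \<Lambda> where "\<Lambda> = max 1 C"
  have d: "d \<ge> 2"
    using dim by (simp add: d_def)
  have \<Lambda>: "\<Lambda> \<ge> 1" "\<Lambda> \<ge> C"
    by (auto simp: \<Lambda>_def)
  interpret rotational_curvature \<phi> "1 / \<Lambda>"
  proof
    show "\<phi> (c *\<^sub>R p) = c * \<phi> p" if "c > 0" for c p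
      using homogeneous[OF that, of "fst p" "snd p"] by (simp add: scaleR_prod_def)
    show "C_class_on 2 \<phi> (- {0})"
      using dim by (intro C_class_on_mono[OF _ smooth]) (auto simp: open_Compl)
    show "grad_x \<phi> p \<noteq> 0" if "p \<in> cball 0 1 \<times> cball 0 1" "\<phi> p > 0" for p
      using gradients[OF that(2)] that(1) by blast
    show "det (monge_ampere_matrix \<phi> p) \<noteq> 0" if "p \<in> cball 0 1 \<times> cball 0 1" "\<phi> p > 0" for p
      using monge_ampere[OF that(2,1) refl] .
  qed (use \<Lambda> dim in auto)
  obtain K where K: "K > 0" "\<And>r t. \<lbrakk>r \<ge> 1; t \<ge> 1 / \<Lambda> * r ^ (CARD('n) + 1)\<rbrakk> \<Longrightarrow>
      real (card (pairs r t)) \<le> K * r ^ (2 * CARD('n) * CARD('n))"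
    by (rule pairs_card_le) (rule that; assumption)
  \<comment> \<open>With r^(d+1) = \<open>\<Lambda> * q\<close>, the power r^(2 d^2) has exponent
    \<open>e1\<close> in \<open>\<Lambda> * q\<close>, and division by the interval length r^(1-d)
    raises the exponent to \<open>e2\<close>. Subtracting \<open>d\<close> gives the two exponents
    of the claim.\<close>
  define e1 where "e1 = 2 * d * d / (d + 1)"
  define e2 where "e2 = 2 * d - 1"
  have e1: "e1 - d = d - 2 + 2 / (d + 1)"
    using d by (simp add: e1_def field_simps)
  show ?thesis
  proof (intro exI[of _ "K * (\<Lambda> powr e1 + \<Lambda> powr e2)"] allI impI)
    fix q \<delta> :: real
    assume q: "q \<ge> 1" and \<delta>: "\<delta> > 0"
    let ?A = "{(n, m). n \<in> (int_points :: (real^'n) set) \<and> m \<in> (int_points :: (real^'n) set) \<and>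
        norm n \<le> C * q \<and> norm m \<le> C * q \<and> q \<le> \<phi> (n, m) \<and> \<phi> (n, m) \<le> q + \<delta>}"
    let ?max = "max (q powr (real CARD('n) - 2 + 2 / (real CARD('n) + 1))) (q powr (real CARD('n) - 1) * \<delta>)"
    define r where "r = (\<Lambda> * q) powr (1 / (d + 1))"
    define \<delta>0 where "\<delta>0 = 1 / r ^ (CARD('n) - 1)"
    \<comment> \<open>The interval is covered by \<open>N + 1\<close> pieces of length
      \<open>\<delta>0\<close>. In the bound \<open>\<delta> / \<delta>0 + 1\<close> for their
      number, the summand 1 produces the first term of the maximum and the quotient the
      second.\<close>
    define N where "N = nat \<lfloor>\<delta> / \<delta>0\<rfloor>"
    have Q: "\<Lambda> * q \<ge> 1"
      using \<Lambda> q mult_mono[of 1 \<Lambda> 1 q] by simp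
    have r: "r \<ge> 1"
      unfolding r_def using Q d by (intro ge_one_powr_ge_zero) auto
    have r_pow: "r ^ k = (\<Lambda> * q) powr (real k / (d + 1))" for k
    proof -
      have "\<Lambda> * q \<noteq> 0"
        using Q by linarith
      then show ?thesis
        unfolding r_def by (subst powr_power) simp_all
    qed
    have rQ: "r ^ (CARD('n) + 1) = \<Lambda> * q"
    proof -
      have eq: "real (CARD('n) + 1) / (d + 1) = 1"
        using d by (simp add: d_def)
      show ?thesis
        unfolding r_pow eq using Q by simp
    qed
    have \<delta>0: "\<delta>0 > 0"
      using r by (simp add: \<delta>0_def)
    have "?A \<subseteq> (\<Union>k\<in>{..N}. pairs r (q + real k * \<delta>0))"
    proof (clarify)
      fix n m :: "real^'n"
      assume nm: "n \<in> int_points" "m \<in> int_points" "norm n \<le> C * q" "norm m \<le> C * q"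
        "q \<le> \<phi> (n, m)" "\<phi> (n, m) \<le> q + \<delta>"
      define k where "k = nat \<lfloor>(\<phi> (n, m) - q) / \<delta>0\<rfloor>"
      have nonneg: "(\<phi> (n, m) - q) / \<delta>0 \<ge> 0"
        using nm(5) \<delta>0 by simp
      have "k \<le> N"
        unfolding k_def N_def using nm(6) \<delta>0 by (intro nat_mono floor_mono divide_right_mono) auto
      moreover have "real k \<le> (\<phi> (n, m) - q) / \<delta>0" "(\<phi> (n, m) - q) / \<delta>0 \<le> real k + 1"
        unfolding k_def using nonneg by linarith+
      then have "q + real k * \<delta>0 \<le> \<phi> (n, m)" "\<phi> (n, m) \<le> q + real k * \<delta>0 + \<delta>0"
        using \<delta>0 by (simp_all add: le_divide_eq divide_le_eq algebra_simps)
      moreover have "C * q \<le> \<Lambda> * q"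
        using \<Lambda> q by (intro mult_right_mono) auto
      ultimately show "(n, m) \<in> (\<Union>k\<in>{..N}. pairs r (q + real k * \<delta>0))"
        using nm unfolding pairs_def rQ \<delta>0_def[symmetric] by (auto intro!: bexI[of _ k])
    qed
    then have "card ?A \<le> card (\<Union>k\<in>{..N}. pairs r (q + real k * \<delta>0))"
      by (intro card_mono finite_UN_I finite_pairs) auto
    also have "\<dots> \<le> (\<Sum>k\<in>{..N}. card (pairs r (q + real k * \<delta>0)))"
      by (rule card_UN_le) simp
    finally have "real (card ?A) \<le> (\<Sum>k\<in>{..N}. real (card (pairs r (q + real k * \<delta>0))))"
      by (simp only: of_nat_sum[symmetric] of_nat_le_iff)
    also have "\<dots> \<le> real (card {..N}) * (K * r ^ (2 * CARD('n) * CARD('n)))"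
    proof (intro sum_bounded_above K(2) r)
      show "1 / \<Lambda> * r ^ (CARD('n) + 1) \<le> q + real k * \<delta>0" for k
        unfolding rQ using \<Lambda> \<delta>0 by simp
    qed
    also have "\<dots> \<le> (\<delta> / \<delta>0 + 1) * (K * r ^ (2 * CARD('n) * CARD('n)))"
    proof (rule mult_right_mono)
      have "real N \<le> \<delta> / \<delta>0"
        unfolding N_def using \<delta> \<delta>0 by (intro of_nat_floor) simp
      then show "real (card {..N}) \<le> \<delta> / \<delta>0 + 1"
        by simp
    qed (use K(1) r in simp)
    also have "\<dots> = K * (\<delta> * r ^ (CARD('n) - 1 + 2 * CARD('n) * CARD('n)) + r ^ (2 * CARD('n) * CARD('n)))"
      unfolding \<delta>0_def power_add by (simp add: algebra_simps)
    also have "r ^ (CARD('n) - 1 + 2 * CARD('n) * CARD('n)) = (\<Lambda> * q) powr e2"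
    proof -
      have "real (CARD('n) - 1 + 2 * CARD('n) * CARD('n)) = e2 * (d + 1)"
        using dim by (simp add: e2_def d_def of_nat_diff algebra_simps)
      moreover have "d + 1 \<noteq> 0"
        using d by linarith
      ultimately have eq: "real (CARD('n) - 1 + 2 * CARD('n) * CARD('n)) / (d + 1) = e2"
        by (metis nonzero_mult_div_cancel_right)
      show ?thesis
        unfolding r_pow eq ..
    qed
    also have "r ^ (2 * CARD('n) * CARD('n)) = (\<Lambda> * q) powr e1"
      unfolding r_pow by (simp add: e1_def d_def)
    finally have "q powr - d * real (card ?A) \<le> q powr - d * (K * (\<delta> * (\<Lambda> * q) powr e2 + (\<Lambda> * q) powr e1))"
      by (intro mult_left_mono) auto
    also have "\<dots> = K * (\<Lambda> powr e1 * (q powr e1 * q powr - d) + \<Lambda> powr e2 * (q powr e2 * q powr - d * \<delta>))"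
      using \<Lambda> q by (simp add: powr_mult algebra_simps)
    also have "q powr e1 * q powr - d = q powr (d - 2 + 2 / (d + 1))"
      unfolding powr_add[symmetric] e1[symmetric] by simp
    also have "q powr e2 * q powr - d = q powr (d - 1)"
      unfolding powr_add[symmetric] by (simp add: e2_def)
    also have "K * (\<Lambda> powr e1 * q powr (d - 2 + 2 / (d + 1)) + \<Lambda> powr e2 * (q powr (d - 1) * \<delta>))
        \<le> K * (\<Lambda> powr e1 * ?max + \<Lambda> powr e2 * ?max)"
      using K(1) unfolding d_def by (intro mult_left_mono add_mono) auto
    also have "\<dots> = K * (\<Lambda> powr e1 + \<Lambda> powr e2) * ?max"
      by (simp add: algebra_simps)
    finally show "q powr (- real CARD('n)) * real (card ?A) \<le> K * (\<Lambda> powr e1 + \<Lambda> powr e2) * ?max"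
      unfolding d_def .
  qed
qed

end
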